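(* Let $D\subset S^2$ be an oriented knot diagram with a basepoint $p$ on one of its edges. Let $r_1,\dots,r_n$ be the regions of $D$, numbered so that $r_{n-1}$ and $r_n$ are the two regions adjacent to the edge containing $p$, and let $e_1,\dots,e_m$ be the edges of $D$ not containing $p$. (a) Let $R'=\mathbb F_2(x_1,\dots,x_{n-2})$. There exist weights $w_1,\dots,w_m\in R'$, each an $\mathbb F_2$-linear combination of $x_1,\dots,x_{n-2}$, such that the reduced twisted Khovanov complex of $D$ over $R'$ with one marking of weight $w_j$ on each edge $e_j$ coincides with Roberts' totally twisted Khovanov complex of $D$ with region labels $x_1,\dots,x_{n-2}$. (b) Conversely, let $R$ be a commutative ring of characteristic $2$ and let $w_1,\dots,w_m\in R$. The reduced twisted Khovanov complex of $D$ over $R$ with one marking of weight $w_j$ on each edge $e_j$ is obtained from Roberts' definition by specializing each $x_i$, $1\le i\le n-2$, to the sum of the weights of the markings on the edges in the boundary of the region $r_i$.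
   Context: $D$ is viewed as a $4$-valent plane graph on $S^2$; its edges are the edges of this graph and its regions are the connected components of $S^2\setminus D$. **Reduced Khovanov complex.** Let $R$ be a commutative ring of characteristic $2$. The $\delta$-graded reduced Khovanov complex $(C,d)$ of $D$ over $R$ is the following. To each complete resolution of the crossings of $D$ associate the tensor product over $R$ of one copy of $A=R[x]/(x^2)$ for each circle of the resolution not containing $p$ (the circle containing $p$ contributes $R=A/(x)$). $C$ is the direct sum over all resolutions with the usual Khovanov grading shifts. The differential $d$ is the usual Khovanov differential given by merge maps (multiplication of $A$) and split maps ($1\mapsto 1\otimes x+x\otimes 1$, $x\mapsto x\otimes x$), induced on the quotient in which $x$ acts as zero on the circle containing $p$. The $\delta$-grading is twice the usual homological grading minus the $q$-grading, where multiplication by $x$ has $q$-degree $-2$. For a circle $c$ not containing $p$, $x_c$ denotes multiplication by $x$ in the tensor factor of $c$. **Reduced twisted Khovanov complex.** Given one marking of weight $w_j\in R$ on each edge $e_j$, it is $C$ with differential $d+\sum_j w_j X_j$. Here $X_j$ acts on each resolution as $x_c$, where $c$ is the circle containing the marked point of $e_j$, and as $0$ if that circle contains $p$. (This is the tensor product of the Khovanov complexes of the crossings with, for each marking, the arc with differential $w_j$ times a dot, reduced by letting a dot at $p$ act as zero.) **Roberts' totally twisted Khovanov complex.** Given region labels (elements of $R$) $x_1,\dots,x_n$ for $r_1,\dots,r_n$, it is $C$ with differential $d+\partial$, where $\partial$ acts on each resolution as $\sum_c[c]\,x_c$. The sum is over the circles $c$ not containing $p$, and $[c]$ is the sum of the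 labels of the regions of $D$ contained in the component of $S^2\setminus c$ not containing $p$. The labels $x_{n-1},x_n$ of the two regions adjacent to the basepoint never appear in the differential, so only $x_1,\dots,x_{n-2}$ are needed. Roberts' original theory uses independent variables $x_i$ over the field $\mathbb F_2(x_1,\dots,x_n)$; the same theory is considered over $\mathbb F_2(x_1,\dots,x_{n-2})$. *)

theory Defs
  imports
    Complex_Main
    "HOL-Library.FuncSet"
    "HOL-Library.Z2"
    "HOL-Library.Poly_Mapping"
    "HOL-Computational_Algebra.Fraction_Field"
begin

section \<open>Oriented knot diagrams on the sphere\<close>

text \<open>
  A diagram with k crossings is given by its signed Gauss code. Following the orientation,
  the edges are numbered 0, ..., 2k - 1 cyclically, so that a strand arriving at a crossing along
  edge e leaves it along edge e + 1 (mod 2k). A crossing records the edges along which the under-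
  and the overstrand arrive, and its sign. The crossingless diagram has the single edge 0, a circle
  without vertices.
\<close>

record crossing =
  under :: nat
  over :: nat
  positive :: bool

type_synonym diagram = "crossing list"

definition num_edges :: "diagram \<Rightarrow> nat" where
  "num_edges D = max 1 (2 * length D)"

definition edges :: "diagram \<Rightarrow> nat set" where
  "edges D = {..<num_edges D}"

definition next_edge :: "diagram \<Rightarrow> nat \<Rightarrow> nat" where
  "next_edge D e = (e + 1) mod num_edges D"

text \<open>The two halves of an edge e: \<open>Arr e\<close> is the terminal half, arriving at a crossing,
  and \<open>Dep e\<close> the initial half, departing from a crossing.\<close>

datatype half_edge = Arr (edge_of: nat) | Dep (edge_of: nat)

text \<open>The four half-edges at the i-th crossing in counterclockwise order, starting from the incoming
  understrand (the order of planar diagram codes); the index j is read modulo 4.\<close>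

definition spoke :: "diagram \<Rightarrow> nat \<Rightarrow> nat \<Rightarrow> half_edge" where
  "spoke D i j =
    (let u = under (D ! i); v = over (D ! i) in
     (if positive (D ! i)
      then [Arr u, Dep (next_edge D v), Dep (next_edge D u), Arr v]
      else [Arr u, Arr v, Dep (next_edge D u), Dep (next_edge D v)]) ! (j mod 4))"

text \<open>An edge side \<open>(e, LeftSide)\<close> stands for the points of the complement of the diagram just to the
  left of e. Seen from the crossing, left and right are exchanged for arriving half-edges.\<close>

datatype side = LeftSide | RightSide

type_synonym edge_side = "nat \<times> side"

fun ccw_side :: "half_edge \<Rightarrow> edge_side" where
  "ccw_side (Arr e) = (e, RightSide)"
| "ccw_side (Dep e) = (e, LeftSide)"

fun cw_side :: "half_edge \<Rightarrow> edge_side" where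
  "cw_side (Arr e) = (e, LeftSide)"
| "cw_side (Dep e) = (e, RightSide)"

definition edge_sides :: "diagram \<Rightarrow> edge_side set" where
  "edge_sides D = edges D \<times> UNIV"

definition classes :: "'b set \<Rightarrow> ('b \<times> 'b) set \<Rightarrow> 'b set set" where
  "classes A Q = A // {(a, b). a \<in> A \<and> b \<in> A \<and> (a, b) \<in> (Q \<union> Q\<inverse>)\<^sup>*}"

text \<open>The two edge sides at each of the four corners of a crossing lie in the same region.\<close>

definition corner_rel :: "diagram \<Rightarrow> (edge_side \<times> edge_side) set" where
  "corner_rel D =
    {(ccw_side (spoke D i j), cw_side (spoke D i (Suc j))) | i j. i < length D \<and> j < 4}"

text \<open>A region is represented by the set of edge sides contained in it.\<close>

definition regions :: "diagram \<Rightarrow> edge_side set set" where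
  "regions D = classes (edge_sides D) (corner_rel D)"

definition boundary_edges :: "edge_side set \<Rightarrow> nat set" where
  "boundary_edges r = fst ` r"

text \<open>The underlying graph is connected, with k vertices and 2k edges, so by Euler's formula its
  rotation system is one of a graph on the sphere iff there are k + 2 regions. The crossingless
  diagram also satisfies this.\<close>

definition knot_diagram :: "diagram \<Rightarrow> bool" where
  "knot_diagram D \<longleftrightarrow>
     distinct (map under D @ map over D) \<and>
     set (map under D @ map over D) = {..<2 * length D} \<and>
     card (regions D) = length D + 2"


section \<open>Resolutions\<close>

text \<open>A complete resolution is the set s of indices of the crossings that are 1-resolved.
  The 0-resolution joins the half-edges 0, 1 and the half-edges 2, 3 of \<open>spoke\<close>, the 1-resolution
  joins 1, 2 and 3, 0; so the oriented resolution of a positive crossing is the 0-resolution.\<close>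

definition resolutions :: "diagram \<Rightarrow> nat set set" where
  "resolutions D = Pow {..<length D}"

definition offset :: "nat set \<Rightarrow> nat \<Rightarrow> nat" where
  "offset s i = (if i \<in> s then 1 else 0)"

definition arc_rel :: "diagram \<Rightarrow> nat set \<Rightarrow> (nat \<times> nat) set" where
  "arc_rel D s =
    {(edge_of (spoke D i j), edge_of (spoke D i (Suc j))) | i j.
       i < length D \<and> j \<in> {offset s i, offset s i + 2}}"

text \<open>A circle is represented by the set of edges of the diagram that it runs through.\<close>

definition circles :: "diagram \<Rightarrow> nat set \<Rightarrow> nat set set" where
  "circles D s = classes (edges D) (arc_rel D s)"

text \<open>The connected components of the complement of the circle c of the resolution s, each
  represented by the edge sides it contains. One can move inside a region, across an edge not on c,
  and between the two arcs of a resolved crossing.\<close>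

definition gap_rel :: "diagram \<Rightarrow> nat set \<Rightarrow> (edge_side \<times> edge_side) set" where
  "gap_rel D s =
    {(ccw_side (spoke D i (offset s i + 1)), ccw_side (spoke D i (offset s i + 3))) | i. i < length D}"

definition components :: "diagram \<Rightarrow> nat set \<Rightarrow> nat set \<Rightarrow> edge_side set set" where
  "components D s c =
    classes (edge_sides D)
      (corner_rel D \<union> gap_rel D s \<union> {((e, LeftSide), (e, RightSide)) | e. e \<in> edges D - c})"


section \<open>The reduced Khovanov complex\<close>

text \<open>The basis of the tensor product at the resolution s consists of the pairs \<open>(s, X)\<close>,
  where X is the set of circles labelled x, the other circles being labelled 1. A basis
  element of the reduced complex has label 1 on the circle containing the edge p of the
  basepoint. Elements of the complex over a subring S of the ring \<open>'a\<close> are the functions from the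
  basis to S, extended by 0.\<close>

type_synonym generator = "nat set \<times> nat set set"
type_synonym 'a chain = "generator \<Rightarrow> 'a"

definition generators :: "diagram \<Rightarrow> nat \<Rightarrow> generator set" where
  "generators D p = {(s, X). s \<in> resolutions D \<and> X \<subseteq> {c \<in> circles D s. p \<notin> c}}"

definition chains :: "'a::comm_ring_1 set \<Rightarrow> diagram \<Rightarrow> nat \<Rightarrow> 'a chain set" where
  "chains S D p =
    {v. (\<forall>g \<in> generators D p. v g \<in> S) \<and> (\<forall>g. g \<notin> generators D p \<longrightarrow> v g = 0)}"

definition basis :: "generator \<Rightarrow> 'a::comm_ring_1 chain" where
  "basis g = (\<lambda>h. if h = g then 1 else 0)"

text \<open>The linear map with given values on basis elements. Discarding the terms of f that
  have x on the circle of p amounts to passing to the quotient in which x acts as 0 there.\<close>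

definition linear_map ::
    "diagram \<Rightarrow> nat \<Rightarrow> (generator \<Rightarrow> 'a::comm_ring_1 chain) \<Rightarrow> 'a chain \<Rightarrow> 'a chain" where
  "linear_map D p f v =
    (\<lambda>h. if h \<in> generators D p then \<Sum>g \<in> generators D p. v g * f g h else 0)"

text \<open>The unreduced merge or split map from s to \<open>insert i s\<close>; no signs are needed in
  characteristic 2. The circles in \<open>old\<close> are replaced by those in \<open>new\<close>.\<close>

definition edge_map :: "diagram \<Rightarrow> nat \<Rightarrow> generator \<Rightarrow> 'a::comm_ring_1 chain" where
  "edge_map D i = (\<lambda>(s, X).
    let s' = insert i s;
        old = circles D s - circles D s';
        new = circles D s' - circles D s
    in if card old = 2 \<and> card new = 1
       then (if X \<inter> old = {} then basis (s', X)
             else if old \<subseteq> X then (\<lambda>_. 0)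
             else basis (s', (X - old) \<union> new))
       else if card old = 1 \<and> card new = 2
       then (if old \<subseteq> X then basis (s', (X - old) \<union> new)
             else (\<lambda>h. \<Sum>c \<in> new. basis (s', insert c X) h))
       else (\<lambda>_. 0))"

definition khovanov_d :: "diagram \<Rightarrow> nat \<Rightarrow> 'a::comm_ring_1 chain \<Rightarrow> 'a chain" where
  "khovanov_d D p =
    linear_map D p (\<lambda>(s, X) h. \<Sum>i \<in> {..<length D} - s. edge_map D i (s, X) h)"

definition n_pos :: "diagram \<Rightarrow> int" where
  "n_pos D = int (length (filter positive D))"

definition n_neg :: "diagram \<Rightarrow> int" where
  "n_neg D = int (length (filter (\<lambda>x. \<not> positive x) D))"

definition hom_degree :: "diagram \<Rightarrow> generator \<Rightarrow> int" where
  "hom_degree D = (\<lambda>(s, X). int (card s) - n_neg D)"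

text \<open>Labels 1 and x have q-degree 1 and -1; the circle containing p contributes 0.\<close>

definition q_degree :: "diagram \<Rightarrow> nat \<Rightarrow> generator \<Rightarrow> int" where
  "q_degree D p = (\<lambda>(s, X).
     int (card {c \<in> circles D s. p \<notin> c}) - 2 * int (card X)
     + int (card s) + n_pos D - 2 * n_neg D)"

definition delta_degree :: "diagram \<Rightarrow> nat \<Rightarrow> generator \<Rightarrow> int" where
  "delta_degree D p g = 2 * hom_degree D g - q_degree D p g"

record 'a graded_complex =
  carrier_of :: "'a chain set"
  graded_part :: "int \<Rightarrow> 'a chain set"
  differential :: "'a chain \<Rightarrow> 'a chain"

definition complex_with ::
    "'a::comm_ring_1 set \<Rightarrow> diagram \<Rightarrow> nat \<Rightarrow> ('a chain \<Rightarrow> 'a chain) \<Rightarrow> 'a graded_complex" where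
  "complex_with S D p d =
    \<lparr> carrier_of = chains S D p,
      graded_part = (\<lambda>t. {v \<in> chains S D p. \<forall>g. v g \<noteq> 0 \<longrightarrow> delta_degree D p g = t}),
      differential = (\<lambda>v \<in> chains S D p. d v) \<rparr>"

text \<open>Multiplication by x in the tensor factor of c.\<close>

definition mult_x :: "nat set \<Rightarrow> generator \<Rightarrow> 'a::comm_ring_1 chain" where
  "mult_x c = (\<lambda>(s, X). if c \<in> X then (\<lambda>_. 0) else basis (s, insert c X))"


section \<open>The reduced twisted complex\<close>

definition circle_through :: "diagram \<Rightarrow> nat set \<Rightarrow> nat \<Rightarrow> nat set" where
  "circle_through D s a = (THE c. c \<in> circles D s \<and> a \<in> c)"

definition marking_map :: "diagram \<Rightarrow> nat \<Rightarrow> nat \<Rightarrow> 'a::comm_ring_1 chain \<Rightarrow> 'a chain" where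
  "marking_map D p a = linear_map D p (\<lambda>(s, X).
     let c = circle_through D s a in if p \<in> c then (\<lambda>_. 0) else mult_x c (s, X))"

definition twisted_complex ::
    "'a::comm_ring_1 set \<Rightarrow> diagram \<Rightarrow> nat \<Rightarrow> nat \<Rightarrow> (nat \<Rightarrow> nat) \<Rightarrow> (nat \<Rightarrow> 'a) \<Rightarrow> 'a graded_complex" where
  "twisted_complex S D p m e w =
    complex_with S D p (\<lambda>v g. khovanov_d D p v g + (\<Sum>j = 1..m. w j * marking_map D p (e j) v g))"


section \<open>Roberts' totally twisted complex\<close>

text \<open>The basepoint does not lie on c, so it lies in the component K iff the sides of the
  edge p belong to K; both sides belong to the same component.\<close>

definition circle_label ::
    "diagram \<Rightarrow> nat \<Rightarrow> nat \<Rightarrow> (nat \<Rightarrow> edge_side set) \<Rightarrow> (nat \<Rightarrow> 'a::comm_ring_1) \<Rightarrow> nat set \<Rightarrow> nat set \<Rightarrow> 'a" where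
  "circle_label D p n r x s c =
    (\<Sum>i | i \<in> {1..n} \<and> (\<exists>K \<in> components D s c. (p, LeftSide) \<notin> K \<and> r i \<subseteq> K). x i)"

definition roberts_map ::
    "diagram \<Rightarrow> nat \<Rightarrow> nat \<Rightarrow> (nat \<Rightarrow> edge_side set) \<Rightarrow> (nat \<Rightarrow> 'a::comm_ring_1) \<Rightarrow> 'a chain \<Rightarrow> 'a chain" where
  "roberts_map D p n r x = linear_map D p (\<lambda>(s, X) h.
     \<Sum>c | c \<in> circles D s \<and> p \<notin> c. circle_label D p n r x s c * mult_x c (s, X) h)"

definition roberts_complex ::
    "'a::comm_ring_1 set \<Rightarrow> diagram \<Rightarrow> nat \<Rightarrow> nat \<Rightarrow> (nat \<Rightarrow> edge_side set) \<Rightarrow> (nat \<Rightarrow> 'a) \<Rightarrow> 'a graded_complex" where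
  "roberts_complex S D p n r x =
    complex_with S D p (\<lambda>v g. khovanov_d D p v g + roberts_map D p n r x v g)"


section \<open>Rational functions over the field with two elements\<close>

type_synonym f2_poly = "(nat \<Rightarrow>\<^sub>0 nat) \<Rightarrow>\<^sub>0 bit"

definition f2_polys :: "nat set \<Rightarrow> f2_poly set" where
  "f2_polys V = {f. \<forall>t \<in> Poly_Mapping.keys f. Poly_Mapping.keys t \<subseteq> V}"

text \<open>The field of rational functions over F2 in the variables with index in V, as a subfield
  of the field of rational functions in countably many variables.\<close>

definition f2_ratfuns :: "nat set \<Rightarrow> f2_poly fract set" where
  "f2_ratfuns V = {Fract f g | f g. f \<in> f2_polys V \<and> g \<in> f2_polys V \<and> g \<noteq> 0}"

definition f2_const :: "bit \<Rightarrow> f2_poly fract" where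
  "f2_const a = Fract (Poly_Mapping.single 0 a) 1"

definition f2_var :: "nat \<Rightarrow> f2_poly fract" where
  "f2_var i = Fract (Poly_Mapping.single (Poly_Mapping.single i 1) 1) 1"

end

theory Submission
  imports Defs "HOL-Library.Function_Algebras"
begin

text \<open>
  Work over the field with two elements. By Euler's formula, the coboundaries of functions on the
  regions are as numerous as the edge sets meeting every crossing an even number of times, so every
  such edge set separates the regions into two colours. For a circle c avoiding p this is a discrete
  Jordan curve theorem: \<open>S\<^sup>2 - c\<close> has two components, and exactly the edges on c have their two sides
  in different ones. For the set of all edges it is the checkerboard colouring, by which every edge
  bounds two distinct regions. Hence, if \<open>x\<^sub>i\<close> is the sum of the weights around \<open>r\<^sub>i\<close>, then in [c] the
  weight of an edge is counted twice or never, except on c, where it is counted once; this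
  is (b). For (a), the equations expressing the \<open>x\<^sub>i\<close> by the weights are solved by giving
  to an edge the sum of those \<open>x\<^sub>i\<close> for which a fixed path in the dual graph from \<open>r\<^sub>i\<close> to the
  edge of the basepoint crosses it an odd number of times.
\<close>

section \<open>Classes of a relation\<close>

lemma in_classes_iff:
  "C \<in> classes A Q \<longleftrightarrow> (\<exists>a\<in>A. C = {b \<in> A. (a, b) \<in> (Q \<union> Q\<inverse>)\<^sup>*})"
  unfolding classes_def quotient_def by fastforce

lemma symclosure_sym: "(a, b) \<in> (Q \<union> Q\<inverse>)\<^sup>* \<Longrightarrow> (b, a) \<in> (Q \<union> Q\<inverse>)\<^sup>*"
  using sym_rtrancl[OF sym_Un_converse, of Q] by (meson symD)

lemma classes_linked:
  assumes "C \<in> classes A Q" "a \<in> C" "b \<in> C"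
  shows "(a, b) \<in> (Q \<union> Q\<inverse>)\<^sup>*"
  using assms unfolding in_classes_iff by (auto dest: symclosure_sym intro: rtrancl_trans)

lemma classes_closed:
  assumes "C \<in> classes A Q" "a \<in> C" "(a, b) \<in> (Q \<union> Q\<inverse>)\<^sup>*" "b \<in> A"
  shows "b \<in> C"
  using assms unfolding in_classes_iff by (auto intro: rtrancl_trans)

lemma classes_subset: "C \<in> classes A Q \<Longrightarrow> C \<subseteq> A"
  unfolding in_classes_iff by auto

lemma classes_respect:
  assumes "C \<in> classes A Q" "Q \<subseteq> A \<times> A" "(a, b) \<in> Q"
  shows "a \<in> C \<longleftrightarrow> b \<in> C"
proof -
  have "(a, b) \<in> (Q \<union> Q\<inverse>)\<^sup>*" "(b, a) \<in> (Q \<union> Q\<inverse>)\<^sup>*" "a \<in> A" "b \<in> A" using assms by auto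
  then show ?thesis using classes_closed[OF assms(1)] by blast
qed

lemma classes_nonempty: "C \<in> classes A Q \<Longrightarrow> C \<noteq> {}"
  unfolding in_classes_iff by auto

lemma ex_class: "a \<in> A \<Longrightarrow> \<exists>C\<in>classes A Q. a \<in> C"
  by (rule bexI[of _ "{b \<in> A. (a, b) \<in> (Q \<union> Q\<inverse>)\<^sup>*}"]) (auto simp: in_classes_iff)

lemma classes_unique:
  assumes "C \<in> classes A Q" "C' \<in> classes A Q" "a \<in> C" "a \<in> C'"
  shows "C = C'"
  using classes_closed[OF assms(1) assms(3)] classes_closed[OF assms(2) assms(4)]
    classes_linked[OF assms(1) assms(3)] classes_linked[OF assms(2) assms(4)]
    classes_subset[OF assms(1)] classes_subset[OF assms(2)] by blast

lemma finite_classes: "finite A \<Longrightarrow> finite (classes A Q)"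
  by (rule finite_subset[of _ "Pow A"]) (auto dest: classes_subset)

lemma symclosure_invariant:
  assumes "(a, b) \<in> (Q \<union> Q\<inverse>)\<^sup>*" and "\<And>x y. (x, y) \<in> Q \<Longrightarrow> f x = f y"
  shows "f a = f b"
  using assms(1) by (induction rule: rtrancl_induct) (auto dest: assms(2))


section \<open>Counting over the field with two elements\<close>

lemma bit_double [simp]: "(a::bit) + a = 0" "(a::bit) + (a + b) = b"
  by (cases a; simp)+

declare add_bit_eq_xor [simp del] mult_bit_eq_and [simp del]

lemma card_bit_functions:
  assumes "finite A"
  shows "card {f :: 'b \<Rightarrow> bit. \<forall>a. a \<notin> A \<longrightarrow> f a = 0} = 2 ^ card A"
    and "finite {f :: 'b \<Rightarrow> bit. \<forall>a. a \<notin> A \<longrightarrow> f a = 0}"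
proof -
  have b: "bij_betw (\<lambda>S a. if a \<in> S then 1 else 0) (Pow A) {f :: 'b \<Rightarrow> bit. \<forall>a. a \<notin> A \<longrightarrow> f a = 0}"
    by (rule bij_betwI[where g = "\<lambda>f. {a. f a = 1}"]) (force simp: fun_eq_iff)+
  show "card {f :: 'b \<Rightarrow> bit. \<forall>a. a \<notin> A \<longrightarrow> f a = 0} = 2 ^ card A"
    using bij_betw_same_card[OF b] card_Pow[OF assms] by simp
  show "finite {f :: 'b \<Rightarrow> bit. \<forall>a. a \<notin> A \<longrightarrow> f a = 0}"
    using bij_betw_finite[OF b] assms by simp
qed

text \<open>An invariant function with values in F2 is the indicator of a union of classes, so it
  amounts to a choice of a subset of the classes.\<close>

lemma card_invariant_functions:
  assumes "finite A" "Q \<subseteq> A \<times> A"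
  shows "card {f :: 'b \<Rightarrow> bit. (\<forall>a. a \<notin> A \<longrightarrow> f a = 0) \<and> (\<forall>(a, b)\<in>Q. f a = f b)}
    = 2 ^ card (classes A Q)" (is "card ?F = _")
proof -
  have b: "bij_betw (\<lambda>S a. if a \<in> \<Union>S then 1 else 0) (Pow (classes A Q)) ?F"
  proof (rule bij_betwI[where g = "\<lambda>f. {C \<in> classes A Q. \<forall>a\<in>C. f a = 1}"])
    show "(\<lambda>S a. if a \<in> \<Union>S then 1 else 0) \<in> Pow (classes A Q) \<rightarrow> ?F"
    proof
      fix S assume S: "S \<in> Pow (classes A Q)"
      have "a \<in> \<Union>S \<longleftrightarrow> b \<in> \<Union>S" if "(a, b) \<in> Q" for a b
        using S classes_respect[OF _ assms(2) that] by blast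
      moreover have "\<Union>S \<subseteq> A" using S classes_subset[of _ A Q] by blast
      ultimately show "(\<lambda>a. if a \<in> \<Union>S then 1 else 0) \<in> ?F" by (auto split: if_splits)
    qed
    show "(\<lambda>f. {C \<in> classes A Q. \<forall>a\<in>C. f a = 1}) \<in> ?F \<rightarrow> Pow (classes A Q)"
      by (intro funcsetI PowI Collect_subset)
    show "{C \<in> classes A Q. \<forall>a\<in>C. (if a \<in> \<Union>S then 1 else 0) = (1::bit)} = S"
      if "S \<in> Pow (classes A Q)" for S
    proof (intro set_eqI iffI)
      fix C assume "C \<in> {C \<in> classes A Q. \<forall>a\<in>C. (if a \<in> \<Union>S then 1 else 0) = (1::bit)}"
      then have C: "C \<in> classes A Q" "C \<subseteq> \<Union>S" by (auto split: if_splits)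
      obtain a where a: "a \<in> C" using classes_nonempty[OF C(1)] by blast
      with C(2) obtain C' where C': "a \<in> C'" "C' \<in> S" by blast
      with that have "C' \<in> classes A Q" by blast
      from classes_unique[OF C(1) this a C'(1)] C'(2) show "C \<in> S" by simp
    next
      fix C assume "C \<in> S"
      then have "C \<in> classes A Q" "C \<subseteq> \<Union>S" using that by blast+
      then show "C \<in> {C \<in> classes A Q. \<forall>a\<in>C. (if a \<in> \<Union>S then 1 else 0) = (1::bit)}"
        by (simp only: mem_Collect_eq) (metis subset_iff)
    qed
    show "(\<lambda>a. if a \<in> \<Union>{C \<in> classes A Q. \<forall>a\<in>C. f a = 1} then 1 else 0) = f" if f: "f \<in> ?F" for f
    proof
      fix a
      have fQ: "f x = f y" if "(x, y) \<in> Q" for x y using f that by blast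
      have "f a = f b" if "C \<in> classes A Q" "a \<in> C" "b \<in> C" for b C
        using symclosure_invariant[OF classes_linked[OF that], of f] fQ by blast
      moreover have "a \<in> A" if "f a = 1" using f that by force
      then have "\<exists>C\<in>classes A Q. a \<in> C" if "f a = 1" using ex_class[of a A Q] that by blast
      ultimately have "(\<exists>C\<in>classes A Q. (\<forall>b\<in>C. f b = 1) \<and> a \<in> C) \<longleftrightarrow> f a = 1" by (metis (no_types))
      then show "(if a \<in> \<Union>{C \<in> classes A Q. \<forall>a\<in>C. f a = 1} then 1 else 0) = f a"
        by (cases "f a = 1") (auto simp: Bex_def)
    qed
  qed
  show ?thesis using bij_betw_same_card[OF b] card_Pow[OF finite_classes[OF assms(1)]] by simp
qed

text \<open>The nonempty fibres of \<open>\<phi>\<close> are cosets of the kernel, hence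
  equinumerous. This counting form of rank-nullity stands in for dimensions over F2.\<close>

lemma card_image_kernel:
  fixes \<phi> :: "'a::ab_group_add \<Rightarrow> 'b::ab_group_add"
  assumes fin: "finite A" and diff: "\<And>a b. a \<in> A \<Longrightarrow> b \<in> A \<Longrightarrow> a - b \<in> A"
    and hom: "\<And>a b. a \<in> A \<Longrightarrow> b \<in> A \<Longrightarrow> \<phi> (a - b) = \<phi> a - \<phi> b"
  shows "card A = card (\<phi> ` A) * card {a \<in> A. \<phi> a = 0}"
proof -
  have add: "a + b \<in> A" "\<phi> (a + b) = \<phi> a + \<phi> b" if "a \<in> A" "b \<in> A" for a b
  proof -
    have m: "- b \<in> A" using diff[OF diff[OF that(2) that(2)] that(2)] by simp
    have "\<phi> (- b) = - \<phi> b" using hom[OF diff[OF that(2) that(2)] that(2)] hom[OF that(2) that(2)] by simp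
    then show "a + b \<in> A" "\<phi> (a + b) = \<phi> a + \<phi> b" using diff[OF that(1) m] hom[OF that(1) m] by auto
  qed
  have "card {a \<in> A. \<phi> a = y} = card {a \<in> A. \<phi> a = 0}" if "y \<in> \<phi> ` A" for y
  proof -
    obtain b where b: "b \<in> A" "y = \<phi> b" using \<open>y \<in> \<phi> ` A\<close> by blast
    have "bij_betw (\<lambda>a. a - b) {a \<in> A. \<phi> a = y} {a \<in> A. \<phi> a = 0}"
      by (rule bij_betwI[where g = "\<lambda>a. a + b"]) (auto simp: b diff hom add)
    then show ?thesis by (rule bij_betw_same_card)
  qed
  then have "(\<Sum>y\<in>\<phi> ` A. card {a \<in> A. \<phi> a = y}) = card (\<phi> ` A) * card {a \<in> A. \<phi> a = 0}" by simp
  moreover have "card A = (\<Sum>y\<in>\<phi> ` A. card {a \<in> A. \<phi> a = y})"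
    using sum.group[OF fin finite_imageI[OF fin], of \<phi> \<phi> "\<lambda>_. 1::nat"] by simp
  ultimately show ?thesis by simp
qed

section \<open>Walking around the diagram\<close>

lemma finite_edges [simp]: "finite (edges D)"
  by (simp add: edges_def)

lemma next_edge_in_edges: "next_edge D e \<in> edges D"
  by (simp add: next_edge_def edges_def num_edges_def)

text \<open>The edges form a single cycle under \<open>next_edge\<close>, since a knot is traversed
  in one go. This takes the place of connectedness of the underlying graph.\<close>

lemma edge_induct:
  assumes "e0 \<in> edges D" "P e0" "e \<in> edges D"
    and step: "\<And>e. e \<in> edges D \<Longrightarrow> P e \<Longrightarrow> P (next_edge D e)"
  shows "P e"
proof -
  have N: "0 < num_edges D" "e0 < num_edges D" "e < num_edges D"
    using assms(1,3) by (auto simp: num_edges_def edges_def)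
  have "P ((e0 + t) mod num_edges D)" for t
  proof (induction t)
    case (Suc t)
    from step[OF _ this] show ?case
      using N by (simp add: edges_def next_edge_def mod_Suc_eq)
  qed (use assms N in auto)
  \<comment> \<open>This number of steps is congruent to the difference of \<open>e\<close> and
    \<open>e0\<close> and avoids negative values.\<close>
  from this[of "num_edges D - e0 + e"] show ?thesis using N by simp
qed

text \<open>Going around the cycle, every edge is reached as a successor; a surjection of a finite
  set onto itself is injective.\<close>

lemma inj_on_next_edge: "inj_on (next_edge D) (edges D)"
proof (rule eq_card_imp_inj_on)
  have "e \<in> next_edge D ` edges D" if "e \<in> edges D" for e
    by (rule edge_induct[of "next_edge D e" D]) (use that next_edge_in_edges in auto)
  then have "next_edge D ` edges D = edges D" using next_edge_in_edges by auto
  then show "card (next_edge D ` edges D) = card (edges D)" by simp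
qed simp

lemma spoke_cong: "j mod 4 = j' mod 4 \<Longrightarrow> spoke D i j = spoke D i j'"
  by (simp add: spoke_def)

lemma corner:
  assumes "i < length D"
  shows "(ccw_side (spoke D i j), cw_side (spoke D i (Suc j))) \<in> corner_rel D"
proof -
  have "spoke D i (j mod 4) = spoke D i j" "spoke D i (Suc (j mod 4)) = spoke D i (Suc j)"
    by (rule spoke_cong; simp add: mod_Suc_eq)+
  then show ?thesis
    using assms unfolding corner_rel_def
    by (intro CollectI exI[of _ i] exI[of _ "j mod 4"]) simp
qed

text \<open>The crossingless diagram is set apart: its only edge carries the basepoint, so no circle
  avoids p, and the count of 2k edges fails for it.\<close>

locale knot =
  fixes D :: diagram
  assumes knot: "knot_diagram D" and nonempty: "D \<noteq> []"
begin

lemma edges_eq: "edges D = {..<2 * length D}"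
  using nonempty by (cases D) (auto simp: edges_def num_edges_def)

lemma arrivals: "distinct (map under D @ map over D)"
    "set (map under D @ map over D) = edges D"
  using knot unfolding knot_diagram_def edges_eq by blast+

lemma under_over_in_edges: "i < length D \<Longrightarrow> under (D ! i) \<in> edges D" "i < length D \<Longrightarrow> over (D ! i) \<in> edges D"
  using arrivals(2) by auto

lemma spoke_in_edges: "i < length D \<Longrightarrow> edge_of (spoke D i j) \<in> edges D"
proof -
  assume i: "i < length D"
  have "j mod 4 \<in> {0,1,2,3}" by auto
  then show ?thesis
    using under_over_in_edges[OF i] next_edge_in_edges by (auto simp: spoke_def Let_def)
qed

lemma straight_on:
  assumes "e \<in> edges D"
  obtains i j where "i < length D" "spoke D i j = Arr e" "spoke D i (j + 2) = Dep (next_edge D e)"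
proof -
  obtain i where i: "i < length D" "e = under (D ! i) \<or> e = over (D ! i)"
    using assms unfolding arrivals(2)[symmetric] by (auto simp: in_set_conv_nth)
  \<comment> \<open>The understrand arrives at spoke 0, the overstrand at spoke 3 or 1 according to
    the sign; each leaves at the opposite spoke.\<close>
  then show ?thesis
    using that[of i 0] that[of i 1] that[of i 3] by (cases "positive (D ! i)") (auto simp: spoke_def Let_def)
qed

lemma corner_rel_subset: "corner_rel D \<subseteq> edge_sides D \<times> edge_sides D"
proof -
  have "ccw_side h \<in> edge_sides D \<and> cw_side h \<in> edge_sides D" if "edge_of h \<in> edges D" for h
    using that by (cases h) (auto simp: edge_sides_def)
  then show ?thesis unfolding corner_rel_def using spoke_in_edges by auto
qed

text \<open>The dual graph is connected.\<close>

lemma edge_side_induct: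
  assumes p: "p \<in> edges D" "P (p, LeftSide)" and a: "a \<in> edge_sides D"
    and corner_step: "\<And>a b. (a, b) \<in> corner_rel D \<Longrightarrow> P a \<longleftrightarrow> P b"
    and cross_step: "\<And>e. e \<in> edges D \<Longrightarrow> P (e, LeftSide) \<longleftrightarrow> P (e, RightSide)"
  shows "P a"
proof -
  have "P (e, LeftSide)" if "e \<in> edges D" for e
  proof (rule edge_induct[where P = "\<lambda>e. P (e, LeftSide)", OF p that])
    fix e assume e: "e \<in> edges D" "P (e, LeftSide)"
    then obtain i j where ij: "i < length D" "spoke D i j = Arr e" "spoke D i (j + 2) = Dep (next_edge D e)"
      using straight_on by metis
    have cr: "P (cw_side h) \<longleftrightarrow> P (ccw_side h)" if "edge_of h \<in> edges D" for h
      using cross_step[OF that] by (cases h) auto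
    \<comment> \<open>Turn counterclockwise about the crossing from the incoming half-edge to the
      opposite outgoing one, alternately crossing a spoke and a corner.\<close>
    have "P (cw_side (spoke D i j))" using e ij by simp
    then have "P (cw_side (spoke D i (Suc j)))" "P (cw_side (spoke D i (Suc (Suc j))))"
      using corner_step[OF corner[OF ij(1)]] cr[OF spoke_in_edges[OF ij(1)]] by blast+
    then show "P (next_edge D e, LeftSide)" using ij cross_step next_edge_in_edges by simp
  qed
  then show ?thesis using a cross_step by (cases a; cases "snd a") (auto simp: edge_sides_def)
qed

end

section \<open>Even edge sets bound\<close>

lemma sum_lessThan_4: "(\<Sum>j<4. h j) = h 0 + h 1 + h 2 + h 3"
  for h :: "nat \<Rightarrow> 'a::comm_monoid_add"
  by (simp add: numeral_eq_Suc lessThan_Suc ac_simps)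

section \<open>Cycles of the underlying graph modulo 2, counted from above\<close>

context knot
begin

text \<open>The cellular boundary of a 1-chain modulo 2. Half-edges are counted, so a loop at a
  crossing cancels itself.\<close>

definition boundary :: "(nat \<Rightarrow> bit) \<Rightarrow> nat \<Rightarrow> bit" where
  "boundary g i = (if i < length D then \<Sum>j<4. g (edge_of (spoke D i j)) else 0)"

definition coboundary :: "(edge_side \<Rightarrow> bit) \<Rightarrow> nat \<Rightarrow> bit" where
  "coboundary f e = (if e \<in> edges D then f (e, LeftSide) + f (e, RightSide) else 0)"

text \<open>For an edge \<open>e\<close> this is the 0-chain of the one crossing at which
  \<open>e\<close> ends.\<close>

definition arrives :: "nat \<Rightarrow> nat \<Rightarrow> bit" where
  "arrives e i = (if i < length D then of_bool (e = under (D ! i)) + of_bool (e = over (D ! i)) else 0)"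

lemma boundary_eq:
  assumes "i < length D"
  shows "boundary g i = g (under (D ! i)) + g (over (D ! i))
    + (g (next_edge D (under (D ! i))) + g (next_edge D (over (D ! i))))"
  using assms by (auto simp: boundary_def sum_lessThan_4 spoke_def Let_def ac_simps)

lemma under_over_distinct:
  assumes "i < length D" "i' < length D"
  shows "under (D ! i) = under (D ! i') \<longleftrightarrow> i = i'" "under (D ! i) \<noteq> over (D ! i')"
proof -
  have d: "distinct (map under D)" "set (map under D) \<inter> set (map over D) = {}"
    using arrivals(1) by (auto simp: distinct_append)
  show "under (D ! i) = under (D ! i') \<longleftrightarrow> i = i'"
    using nth_eq_iff_index_eq[OF d(1), of i i'] assms by simp
  have "under (D ! i) \<in> set (map under D)" "over (D ! i') \<in> set (map over D)" using assms by auto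
  then show "under (D ! i) \<noteq> over (D ! i')" using d(2) by (metis IntI emptyE)
qed

lemma arrives_under: "i < length D \<Longrightarrow> arrives (under (D ! i)) i' = of_bool (i = i')"
  using under_over_distinct by (auto simp: arrives_def)

text \<open>The successor of \<open>e\<close> departs from the crossing at which \<open>e\<close>
  arrives; injectivity of \<open>next_edge\<close> identifies its departing half.\<close>

lemma boundary_edge:
  assumes "e \<in> edges D"
  shows "boundary (\<lambda>e'. of_bool (e' = next_edge D e)) i = arrives e i + arrives (next_edge D e) i"
proof (cases "i < length D")
  case True
  have "next_edge D (under (D ! i)) = next_edge D e \<longleftrightarrow> e = under (D ! i)"
       "next_edge D (over (D ! i)) = next_edge D e \<longleftrightarrow> e = over (D ! i)"
    using inj_on_eq_iff[OF inj_on_next_edge, of _ D e] under_over_in_edges[OF True] assms by auto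
  then show ?thesis using True by (auto simp: boundary_eq arrives_def ac_simps)
qed (simp add: boundary_def arrives_def)

lemma boundary_add: "boundary (\<lambda>e. g e + h e) i = boundary g i + boundary h i"
  by (simp add: boundary_def sum.distrib)

lemma boundary_sum_scaled:
  "boundary (\<lambda>e. \<Sum>t\<in>T. c t * g t e) i = (\<Sum>t\<in>T. c t * boundary (g t) i)"
proof (cases "i < length D")
  case True
  have "(\<Sum>j<4. \<Sum>t\<in>T. c t * g t (edge_of (spoke D i j)))
    = (\<Sum>t\<in>T. \<Sum>j<4. c t * g t (edge_of (spoke D i j)))" by (rule sum.swap)
  then show ?thesis using True by (simp only: boundary_def if_True sum_distrib_left)
qed (simp add: boundary_def)

text \<open>Along a walk on the knot the boundaries of the successive edges telescope modulo
  2.\<close>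

lemma ex_path_boundary:
  assumes "e0 \<in> edges D" "e \<in> edges D"
  shows "\<exists>g. (\<forall>e'. e' \<notin> edges D \<longrightarrow> g e' = 0) \<and> (\<forall>i. boundary g i = arrives e0 i + arrives e i)"
proof (rule edge_induct[where P = "\<lambda>e. \<exists>g. (\<forall>e'. e' \<notin> edges D \<longrightarrow> g e' = 0)
    \<and> (\<forall>i. boundary g i = arrives e0 i + arrives e i)", OF assms(1) _ assms(2)])
  show "\<exists>g. (\<forall>e'. e' \<notin> edges D \<longrightarrow> g e' = 0) \<and> (\<forall>i. boundary g i = arrives e0 i + arrives e0 i)"
    by (rule exI[of _ "\<lambda>_. 0"]) (simp add: boundary_def)
next
  fix e assume e: "e \<in> edges D"
    "\<exists>g. (\<forall>e'. e' \<notin> edges D \<longrightarrow> g e' = 0) \<and> (\<forall>i. boundary g i = arrives e0 i + arrives e i)"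
  then obtain g where g: "\<forall>e'. e' \<notin> edges D \<longrightarrow> g e' = 0" "\<And>i. boundary g i = arrives e0 i + arrives e i"
    by blast
  have "boundary (\<lambda>e'. g e' + of_bool (e' = next_edge D e)) i = arrives e0 i + arrives (next_edge D e) i" for i
    by (simp add: boundary_add boundary_edge[OF e(1)] g(2) add.assoc)
  then show "\<exists>g. (\<forall>e'. e' \<notin> edges D \<longrightarrow> g e' = 0)
      \<and> (\<forall>i. boundary g i = arrives e0 i + arrives (next_edge D e) i)"
    using g(1) next_edge_in_edges
    by (intro exI[of _ "\<lambda>e'. g e' + of_bool (e' = next_edge D e)"]) auto
qed

abbreviation edge_cochains :: "(nat \<Rightarrow> bit) set" where
  "edge_cochains \<equiv> {g. \<forall>e. e \<notin> edges D \<longrightarrow> g e = 0}"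

text \<open>By connectedness every 0-chain becomes a boundary after adding at most one fixed
  crossing, so the boundaries have index at most 2 among all 0-chains.\<close>

lemma card_boundary_image: "2 ^ length D \<le> 2 * card (boundary ` edge_cochains)"
proof -
  let ?S = "boundary ` edge_cochains" and ?V = "{h :: nat \<Rightarrow> bit. \<forall>i. i \<notin> {..<length D} \<longrightarrow> h i = 0}"
  \<comment> \<open>This edge ends at crossing 0, the common starting point of the paths
    \<open>G i\<close> to the crossings i.\<close>
  let ?e0 = "under (D ! 0)"
  have fin: "finite ?S" using card_bit_functions(2)[OF finite_edges] by simp
  have e0: "?e0 \<in> edges D" using under_over_in_edges(1)[of 0] nonempty by simp
  have "\<forall>i\<in>{..<length D}. \<exists>g. g \<in> edge_cochains \<and> boundary g = (\<lambda>i'. arrives ?e0 i' + of_bool (i = i'))"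
  proof
    fix i assume i: "i \<in> {..<length D}"
    obtain g where "g \<in> edge_cochains" "\<And>i'. boundary g i' = arrives ?e0 i' + arrives (under (D ! i)) i'"
      using ex_path_boundary[OF e0, of "under (D ! i)"] under_over_in_edges i by auto
    then show "\<exists>g. g \<in> edge_cochains \<and> boundary g = (\<lambda>i'. arrives ?e0 i' + of_bool (i = i'))"
      using i by (intro exI[of _ g]) (simp add: arrives_under fun_eq_iff)
  qed
  then obtain G where G: "\<And>i. i < length D \<Longrightarrow> G i \<in> edge_cochains"
      "\<And>i i'. i < length D \<Longrightarrow> boundary (G i) i' = arrives ?e0 i' + of_bool (i = i')"
    by (metis (no_types, lifting) lessThan_iff)
  have "h \<in> ?S \<union> (\<lambda>h i. h i + arrives ?e0 i) ` ?S" if h: "h \<in> ?V" for h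
  proof -
    \<comment> \<open>The sum of the paths to the crossings in the support of \<open>h\<close>. Its
      boundary is \<open>h\<close> plus crossing 0, taken as often as the support has
      elements.\<close>
    define g where "g e = (\<Sum>t<length D. h t * G t e)" for e
    have g: "g \<in> edge_cochains" using G(1) unfolding g_def by (auto intro!: sum.neutral)
    have "boundary g i = (\<Sum>t<length D. h t) * arrives ?e0 i + h i" for i
    proof -
      have "boundary g i = (\<Sum>t<length D. h t * (arrives ?e0 i + of_bool (t = i)))"
        unfolding g_def boundary_sum_scaled by (rule sum.cong) (simp_all add: G(2))
      also have "\<dots> = (\<Sum>t<length D. h t) * arrives ?e0 i + (\<Sum>t<length D. if t = i then h t else 0)"
        by (simp add: distrib_left sum.distrib sum_distrib_right)
      also have "(\<Sum>t<length D. if t = i then h t else 0) = h i" using h by auto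
      finally show ?thesis .
    qed
    then have "h = boundary g \<or> h = (\<lambda>i. boundary g i + arrives ?e0 i)"
      by (cases "(\<Sum>t<length D. h t)") (auto simp: fun_eq_iff ac_simps)
    then show ?thesis using g by blast
  qed
  then have "card ?V \<le> card (?S \<union> (\<lambda>h i. h i + arrives ?e0 i) ` ?S)"
    using fin by (intro card_mono) auto
  also have "\<dots> \<le> card ?S + card ?S"
    by (rule order_trans[OF card_Un_le add_left_mono[OF card_image_le[OF fin]]])
  finally show ?thesis using card_bit_functions(1)[of "{..<length D}"] by simp
qed

text \<open>Rank-nullity: 2k dimensions of edge chains, less at least k - 1 dimensions of
  boundaries, leave at most k + 1 for the cycles.\<close>

lemma card_cycles: "card {g \<in> edge_cochains. boundary g = 0} \<le> 2 ^ (length D + 1)"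
proof -
  let ?Z = "{g \<in> edge_cochains. boundary g = 0}"
  have "boundary (g - h) = boundary g - boundary h" for g h
    by (simp add: fun_eq_iff boundary_def sum.distrib)
  then have "card edge_cochains = card (boundary ` edge_cochains) * card ?Z"
    by (intro card_image_kernel card_bit_functions) auto
  moreover have "card edge_cochains = 2 ^ (2 * length D)"
    using card_bit_functions(1)[OF finite_edges, of D] by (simp add: edges_eq)
  ultimately have "2 ^ length D * card ?Z \<le> 2 * 2 ^ (2 * length D)"
    using mult_le_mono1[OF card_boundary_image, of "card ?Z"] by simp
  also have "\<dots> = 2 ^ length D * (2 ^ (length D + 1) :: nat)"
    by (simp add: power_add mult_2 distrib_left)
  finally show ?thesis by simp
qed

section \<open>Functions on the regions, encoded on edge sides, and their coboundaries\<close>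

abbreviation colourings :: "(edge_side \<Rightarrow> bit) set" where
  "colourings \<equiv> {f. (\<forall>a. a \<notin> edge_sides D \<longrightarrow> f a = 0) \<and> (\<forall>(a, b)\<in>corner_rel D. f a = f b)}"

lemma colouring_corner: "f \<in> colourings \<Longrightarrow> (a, b) \<in> corner_rel D \<Longrightarrow> f a = f b"
  by (drule CollectD, drule conjunct2, drule (1) bspec) simp

lemma colouring_outside: "f \<in> colourings \<Longrightarrow> a \<notin> edge_sides D \<Longrightarrow> f a = 0"
  by (drule CollectD, drule conjunct1) blast

lemma finite_edge_sides: "finite (edge_sides D)"
proof -
  have "(UNIV :: side set) = {LeftSide, RightSide}" using side.exhaust by blast
  then have "finite (UNIV :: side set)" by (rule ssubst) simp
  then show ?thesis by (simp add: edge_sides_def)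
qed

text \<open>Each of the four corners at a crossing lies beside two spokes, so its colour is counted
  twice.\<close>

lemma boundary_coboundary: "f \<in> colourings \<Longrightarrow> boundary (coboundary f) = 0"
proof
  fix i assume f: "f \<in> colourings"
  show "boundary (coboundary f) i = 0 i"
  proof (cases "i < length D")
    case True
    have co: "coboundary f (edge_of (spoke D i j)) = f (ccw_side (spoke D i j)) + f (cw_side (spoke D i j))" for j
      using spoke_in_edges[OF True, of j] by (cases "spoke D i j") (auto simp: coboundary_def ac_simps)
    have cw: "f (cw_side (spoke D i (Suc j))) = f (ccw_side (spoke D i j))" for j
      using colouring_corner[OF f corner[OF True, of j]] by simp
    have c4: "f (cw_side (spoke D i 0)) = f (ccw_side (spoke D i 3))"
      using cw[of 3] spoke_cong[of 4 0 D i] by simp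
    show ?thesis using True cw[of 0] cw[of 1] cw[of 2] c4
      by (simp add: boundary_def sum_lessThan_4 co numeral_2_eq_2 numeral_3_eq_3 ac_simps)
  qed (simp add: boundary_def)
qed

lemma colourings_diff:
  assumes "f \<in> colourings" "f' \<in> colourings"
  shows "f - f' \<in> colourings"
proof (intro CollectI conjI allI impI ballI)
  show "(f - f') a = 0" if "a \<notin> edge_sides D" for a
    using colouring_outside[OF assms(1) that] colouring_outside[OF assms(2) that] by simp
  show "case x of (a, b) \<Rightarrow> (f - f') a = (f - f') b" if "x \<in> corner_rel D" for x
    using colouring_corner[OF assms(1), of "fst x" "snd x"] colouring_corner[OF assms(2), of "fst x" "snd x"]
      that by (cases x) simp
qed

text \<open>Euler's formula says that the coboundaries, \<open>2 ^ (k + 1)\<close> in number, exhaust the cycles.\<close>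

lemma even_edge_set_bounds:
  assumes "g \<in> edge_cochains" "boundary g = 0"
  obtains f where "f \<in> colourings" "\<And>e. e \<in> edges D \<Longrightarrow> f (e, LeftSide) + f (e, RightSide) = g e"
proof -
  let ?Z = "{g \<in> edge_cochains. boundary g = 0}" and ?K = "{f \<in> colourings. coboundary f = 0}"
  have fin: "finite colourings"
    by (rule finite_subset[OF _ card_bit_functions(2)[OF finite_edge_sides]])
      (intro subsetI, rule CollectI, intro allI impI, erule (1) colouring_outside)
  have sub: "coboundary ` colourings \<subseteq> ?Z"
  proof
    fix g assume "g \<in> coboundary ` colourings"
    then obtain f where "f \<in> colourings" "g = coboundary f" by (rule imageE)
    then show "g \<in> ?Z" using boundary_coboundary[of f] by (simp add: coboundary_def)
  qed
  \<comment> \<open>A colouring with zero coboundary does not change across any edge, so it is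
    constant because the dual graph is connected.\<close>
  have "?K \<subseteq> {\<lambda>a. 0, \<lambda>a. of_bool (a \<in> edge_sides D)}"
  proof
    fix f assume f: "f \<in> ?K"
    obtain e where e: "e \<in> edges D" using next_edge_in_edges by blast
    have "f a = f (e, LeftSide)" if "a \<in> edge_sides D" for a
    proof (rule edge_side_induct[where P = "\<lambda>a. f a = f (e, LeftSide)", OF e refl that])
      fix e' assume "e' \<in> edges D"
      moreover have "coboundary f e' = 0" using f by simp
      ultimately have "f (e', LeftSide) + f (e', RightSide) = 0" by (simp add: coboundary_def)
      then have "f (e', LeftSide) = f (e', RightSide)"
        by (cases "f (e', LeftSide)"; cases "f (e', RightSide)") auto
      then show "(f (e', LeftSide) = f (e, LeftSide)) = (f (e', RightSide) = f (e, LeftSide))" by simp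
    next
      fix a b assume "(a, b) \<in> corner_rel D"
      then have "f a = f b" using colouring_corner f by blast
      then show "(f a = f (e, LeftSide)) = (f b = f (e, LeftSide))" by simp
    qed
    moreover have "f a = 0" if "a \<notin> edge_sides D" for a using colouring_outside[OF _ that] f by blast
    ultimately have "f = (\<lambda>a. f (e, LeftSide) * of_bool (a \<in> edge_sides D))" by (intro ext) simp
    then have "f = (\<lambda>a. c * of_bool (a \<in> edge_sides D))" if "f (e, LeftSide) = c" for c using that by simp
    then show "f \<in> {\<lambda>a. 0, \<lambda>a. of_bool (a \<in> edge_sides D)}"
      by (cases "f (e, LeftSide)") auto
  qed
  then have "card ?K \<le> card {\<lambda>a. 0, \<lambda>a. of_bool (a \<in> edge_sides D) :: bit}" by (intro card_mono) auto
  also have "\<dots> \<le> 2" by (simp add: card_insert_if)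
  finally have K: "card ?K \<le> 2" .
  have "coboundary (f - f') = coboundary f - coboundary f'" for f f'
    by (simp add: fun_eq_iff coboundary_def)
  then have "card colourings = card (coboundary ` colourings) * card ?K"
    using fin colourings_diff by (intro card_image_kernel)
  \<comment> \<open>Sphericity enters here, through the number k + 2 of regions.\<close>
  moreover have "card colourings = 2 ^ (length D + 2)"
    using card_invariant_functions[OF finite_edge_sides corner_rel_subset] knot
    by (simp add: knot_diagram_def regions_def)
  ultimately have "2 ^ (length D + 2) \<le> card (coboundary ` colourings) * 2"
    using mult_le_mono2[OF K, of "card (coboundary ` colourings)"] by simp
  \<comment> \<open>The coboundary map is at most two-to-one, so it has at least
    \<open>2 ^ (k + 1)\<close> values, as many as the bound on the cycles allows.\<close>
  then have "card ?Z \<le> card (coboundary ` colourings)" using card_cycles by simp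
  moreover have "finite ?Z" using card_bit_functions(2)[OF finite_edges] by (rule rev_finite_subset) (rule Collect_restrict)
  ultimately have "coboundary ` colourings = ?Z" using sub by (intro card_seteq)
  moreover have "g \<in> ?Z" using assms by simp
  ultimately have "g \<in> coboundary ` colourings" by (simp only:)
  then obtain f where f: "g = coboundary f" "f \<in> colourings" by (rule imageE)
  show ?thesis by (rule that[OF f(2)]) (simp add: f(1) coboundary_def)
qed

end

section \<open>A circle separates the sphere into two components\<close>

abbreviation component_rel :: "diagram \<Rightarrow> nat set \<Rightarrow> nat set \<Rightarrow> (edge_side \<times> edge_side) set" where
  "component_rel D s c \<equiv>
    corner_rel D \<union> gap_rel D s \<union> {((e, LeftSide), (e, RightSide)) | e. e \<in> edges D - c}"

lemma offset_cases: "offset s i = 0 \<or> offset s i = 1"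
  by (simp add: offset_def)

text \<open>Corner j lies between spokes j and j + 1. The arcs of the resolution cut off the corners
  with \<open>j + offset s i\<close> even; the other two are merged by the gap.\<close>

lemma gap_opposite:
  assumes "i < length D" "odd (j + offset s i)"
    and gap: "\<And>a b. (a, b) \<in> gap_rel D s \<Longrightarrow> q a = q b"
  shows "q (ccw_side (spoke D i j)) = q (ccw_side (spoke D i (j + 2)))"
proof -
  have g: "q (ccw_side (spoke D i (offset s i + 1))) = q (ccw_side (spoke D i (offset s i + 3)))"
    using assms(1) by (intro gap) (auto simp: gap_rel_def)
  have "j mod 4 = (offset s i + 1) mod 4 \<and> (j + 2) mod 4 = (offset s i + 3) mod 4 \<or>
        j mod 4 = (offset s i + 3) mod 4 \<and> (j + 2) mod 4 = (offset s i + 1) mod 4"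
    using offset_cases[of s i] assms(2) by (elim disjE) (simp_all, presburger+)
  then show ?thesis
    using spoke_cong[of j "offset s i + 1" D i] spoke_cong[of "j + 2" "offset s i + 3" D i]
      spoke_cong[of j "offset s i + 3" D i] spoke_cong[of "j + 2" "offset s i + 1" D i] g
    by (elim disjE) simp_all
qed

lemma arc:
  assumes "i < length D" "even (j + offset s i)"
  shows "(edge_of (spoke D i j), edge_of (spoke D i (Suc j))) \<in> arc_rel D s"
proof -
  have "j mod 4 = offset s i mod 4 \<and> Suc j mod 4 = Suc (offset s i) mod 4 \<or>
        j mod 4 = (offset s i + 2) mod 4 \<and> Suc j mod 4 = Suc (offset s i + 2) mod 4"
    using offset_cases[of s i] assms(2) by (elim disjE) (simp_all, presburger+)
  then have "\<exists>j'\<in>{offset s i, offset s i + 2}. spoke D i j = spoke D i j' \<and> spoke D i (Suc j) = spoke D i (Suc j')"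
    using spoke_cong[of j "offset s i" D i] spoke_cong[of "Suc j" "Suc (offset s i)" D i]
      spoke_cong[of j "offset s i + 2" D i] spoke_cong[of "Suc j" "Suc (offset s i + 2)" D i]
    by (elim disjE) simp_all
  then obtain j' where "j' \<in> {offset s i, offset s i + 2}" "spoke D i j = spoke D i j'" "spoke D i (Suc j) = spoke D i (Suc j')"
    by blast
  then show ?thesis
    using assms(1) unfolding arc_rel_def by (intro CollectI exI[of _ i] exI[of _ j']) simp
qed

text \<open>A function constant on each component and changing across every edge of
  \<open>c\<close>. Its existence is the half of the Jordan curve theorem saying that
  \<open>c\<close> separates.\<close>

definition sides_colouring :: "diagram \<Rightarrow> nat set \<Rightarrow> nat set \<Rightarrow> (edge_side \<Rightarrow> bit) \<Rightarrow> bool" where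
  "sides_colouring D s c f \<longleftrightarrow>
    (\<forall>a b. (a, b) \<in> component_rel D s c \<longrightarrow> f a = f b) \<and>
    (\<forall>e\<in>c. f (e, LeftSide) \<noteq> f (e, RightSide))"

context knot
begin

lemma arc_rel_subset: "arc_rel D s \<subseteq> edges D \<times> edges D"
  using spoke_in_edges by (auto simp: arc_rel_def)

lemma circle_arc:
  assumes "c \<in> circles D s" "i < length D" "even (j + offset s i)"
  shows "edge_of (spoke D i j) \<in> c \<longleftrightarrow> edge_of (spoke D i (Suc j)) \<in> c"
  using classes_respect[OF assms(1)[unfolded circles_def] arc_rel_subset arc[OF assms(2,3)]] .

text \<open>The two arcs pair up the four spokes, and the spokes of a pair are both on
  \<open>c\<close> or both off it.\<close>

lemma boundary_circle:
  assumes "c \<in> circles D s"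
  shows "boundary (\<lambda>e. of_bool (e \<in> c)) = 0"
proof
  fix i
  show "boundary (\<lambda>e. of_bool (e \<in> c)) i = 0 i"
  proof (cases "i < length D")
    case True
    let ?b = "\<lambda>j. of_bool (edge_of (spoke D i j) \<in> c) :: bit"
    have a: "?b j = ?b (Suc j)" if "even (j + offset s i)" for j
      using circle_arc[OF assms True that] by simp
    have 4: "?b 4 = ?b 0" using spoke_cong[of 4 0 D i] by simp
    have "?b 0 + ?b 1 + ?b 2 + ?b 3 = 0"
      using offset_cases[of s i]
    proof
      assume "offset s i = 0"
      then show ?thesis using a[of 0] a[of 2] by (simp add: numeral_2_eq_2 numeral_3_eq_3 add.assoc)
    next
      assume o: "offset s i = 1"
      have "?b 1 = ?b 2" using a[of 1] o by (simp add: numeral_2_eq_2)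
      \<comment> \<open>The second arc of a 1-resolution closes up cyclically, from spoke 3 to spoke
        0.\<close>
      moreover have "?b 3 = ?b (Suc 3)" by (rule a) (simp add: o)
      with 4 have "?b 3 = ?b 0" by simp
      ultimately show ?thesis by (simp add: ac_simps)
    qed
    then show ?thesis using True by (simp add: boundary_def sum_lessThan_4)
  qed (simp add: boundary_def)
qed

lemma bit_add_neq: "a + b = of_bool P \<Longrightarrow> (a::bit) \<noteq> b \<longleftrightarrow> P"
  by (cases a; cases b; cases P) auto

text \<open>Being even, \<open>c\<close> bounds a colouring of the regions; it remains to see that
  this colouring agrees on the two ends of each gap.\<close>

lemma ex_sides_colouring:
  assumes "c \<in> circles D s"
  shows "\<exists>f. sides_colouring D s c f"
proof -
  have sub: "c \<subseteq> edges D" using assms unfolding circles_def by (rule classes_subset)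
  have "(\<lambda>e. of_bool (e \<in> c)) \<in> edge_cochains" using sub by auto
  then obtain f where f: "f \<in> colourings" "\<And>e. e \<in> edges D \<Longrightarrow> f (e, LeftSide) + f (e, RightSide) = of_bool (e \<in> c)"
    by (rule even_edge_set_bounds[OF _ boundary_circle[OF assms]]) (rule that)
  have e: "f (e, LeftSide) \<noteq> f (e, RightSide) \<longleftrightarrow> e \<in> c" if "e \<in> edges D" for e
    using bit_add_neq[OF f(2)[OF that]] .
  \<comment> \<open>Turning from one end of the gap to the other crosses the spokes
    \<open>offset s i + 2\<close> and \<open>offset s i + 3\<close>. An arc joins them, so the
    colour changes twice or never.\<close>
  have gap: "f a = f b" if "(a, b) \<in> gap_rel D s" for a b
  proof -
    obtain i where i: "i < length D" "a = ccw_side (spoke D i (offset s i + 1))" "b = ccw_side (spoke D i (offset s i + 3))"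
      using \<open>(a, b) \<in> gap_rel D s\<close> unfolding gap_rel_def by blast
    let ?E = "\<lambda>j. spoke D i j" and ?o = "offset s i"
    have side: "f (ccw_side h) + f (cw_side h) = of_bool (edge_of h \<in> c)" if "edge_of h \<in> edges D" for h
      using f(2)[OF that] by (cases h) (simp_all add: add.commute)
    have "f (cw_side (?E (Suc j))) = f (ccw_side (?E j))" for j
      using colouring_corner[OF f(1) corner[OF i(1), of j]] by simp
    then have "f (ccw_side (?E (Suc j))) + f (ccw_side (?E j)) = of_bool (edge_of (?E (Suc j)) \<in> c)" for j
      using side[OF spoke_in_edges[OF i(1)], of "Suc j"] by simp
    note step = this[of "?o + 1"] this[of "?o + 2"]
    have ev: "even (?o + 2 + ?o)" by simp
    from step
    have "f (ccw_side (?E (?o + 2))) + f (ccw_side (?E (?o + 1))) = f (ccw_side (?E (?o + 3))) + f (ccw_side (?E (?o + 2)))"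
      using circle_arc[OF assms i(1) ev] by (simp add: numeral_2_eq_2 numeral_3_eq_3)
    then show ?thesis using i by (simp add: add.commute)
  qed
  have "f a = f b" if "(a, b) \<in> component_rel D s c" for a b
    using that
  proof (elim UnE)
    assume "(a, b) \<in> {((e, LeftSide), (e, RightSide)) | e. e \<in> edges D - c}"
    then show ?thesis using e by blast
  qed (use gap colouring_corner[OF f(1)] in blast)+
  then show ?thesis using e sub unfolding sides_colouring_def by blast
qed

text \<open>The other half of the Jordan curve theorem: with \<open>q\<close> the component of an
  edge side, every component touches \<open>e0\<close>, so there are at most two. The values on both
  sides are followed along the circle and along the knot.\<close>

lemma sides_linked_to_circle:
  assumes c: "c \<in> circles D s" "e0 \<in> c" and e: "e \<in> edges D"
    and rel: "\<And>a b. (a, b) \<in> component_rel D s c \<Longrightarrow> q a = q b"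
  shows "{q (e, LeftSide), q (e, RightSide)} \<subseteq> {q (e0, LeftSide), q (e0, RightSide)}"
proof -
  define S where "S e = {q (e, LeftSide), q (e, RightSide)}" for e
  have S: "S (edge_of h) = {q (ccw_side h), q (cw_side h)}" for h
    by (cases h) (auto simp: S_def)
  define Q where "Q i j = q (ccw_side (spoke D i j))" for i j
  have Qcw: "q (cw_side (spoke D i (Suc j))) = Q i j" if "i < length D" for i j
    unfolding Q_def by (rule rel[OF UnI1[OF UnI1[OF corner[OF that]]], symmetric])
  have Q4: "Q i (j + 4) = Q i j" "q (cw_side (spoke D i (j + 4))) = q (cw_side (spoke D i j))" for i j
    using spoke_cong[of "j + 4" j D i] by (simp_all add: Q_def)
  have Qcw': "q (cw_side (spoke D i j)) = Q i (j + 3)" if "i < length D" for i j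
    using Qcw[OF that, of "j + 3"] Q4(2)[of i j] by (simp add: eval_nat_numeral)
  have opp: "Q i j = Q i (j + 2)" if "i < length D" "odd (j + offset s i)" for i j
    unfolding Q_def by (rule gap_opposite[OF that]) (rule rel[OF UnI1[OF UnI2]])
  have SQ: "S (edge_of (spoke D i j)) = {Q i j, Q i (j + 3)}" if "i < length D" for i j
    using S Qcw'[OF that] by (simp add: Q_def)
  \<comment> \<open>On one side the arc borders corner j, on the other the corners j + 1 and j + 3,
    which the gap merges.\<close>
  have arc_eq: "S x = S y" if "(x, y) \<in> arc_rel D s" for x y
  proof -
    obtain i j where ij: "i < length D" "j \<in> {offset s i, offset s i + 2}"
        "x = edge_of (spoke D i j)" "y = edge_of (spoke D i (Suc j))"
      using \<open>(x, y) \<in> arc_rel D s\<close> unfolding arc_rel_def by blast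
    then have "odd (Suc j + offset s i)" by auto
    from opp[OF ij(1) this] have "Q i (Suc j) = Q i (j + 3)" by (simp add: eval_nat_numeral)
    moreover have "Q i (Suc j + 3) = Q i j" using Q4(1)[of i j] by (simp add: eval_nat_numeral)
    ultimately show ?thesis using SQ[OF ij(1), of j] SQ[OF ij(1), of "Suc j"] ij(3,4) by auto
  qed
  have circle_eq: "S e = S e0" if "e \<in> c" for e
    by (rule symclosure_invariant[OF classes_linked[OF c(1)[unfolded circles_def] that c(2)] arc_eq])
  have "S e \<subseteq> S e0"
  proof (rule edge_induct[where P = "\<lambda>e. S e \<subseteq> S e0", OF _ subset_refl e])
    show "e0 \<in> edges D" using c classes_subset unfolding circles_def by blast
  next
    fix e assume e: "e \<in> edges D" "S e \<subseteq> S e0"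
    show "S (next_edge D e) \<subseteq> S e0"
    proof (cases "next_edge D e \<in> c")
      case True then show ?thesis using circle_eq by simp
    next
      case False
      obtain i j where ij: "i < length D" "spoke D i j = Arr e" "spoke D i (j + 2) = Dep (next_edge D e)"
        using straight_on[OF e(1)] .
      have "((next_edge D e, LeftSide), (next_edge D e, RightSide)) \<in> component_rel D s c"
        using False next_edge_in_edges by blast
      from rel[OF this] have "Q i (j + 2) = q (cw_side (spoke D i (Suc (Suc j))))" using ij by (simp add: Q_def)
      then have 12: "Q i (j + 2) = Q i (j + 1)" using Qcw[OF ij(1), of "Suc j"] by simp
      have nxt: "S (next_edge D e) = {Q i (j + 1)}"
        using SQ[OF ij(1), of "j + 2"] Q4(1)[of i "j + 1"] 12 ij(3) by (simp add: eval_nat_numeral)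
      \<comment> \<open>Corners j and j + 3 lie beside \<open>e\<close>, corners j + 1 and j + 2
        beside its successor, and the latter two agree. The gap joins either j with j + 2 or j + 1
        with j + 3.\<close>
      have "Q i (j + 1) \<in> {Q i j, Q i (j + 3)}"
      proof (cases "odd (j + offset s i)")
        case True
        from opp[OF ij(1) this] 12 show ?thesis by simp
      next
        case False
        then have "odd (j + 1 + offset s i)" by simp
        from opp[OF ij(1) this] show ?thesis by (simp add: eval_nat_numeral)
      qed
      then show ?thesis using nxt SQ[OF ij(1), of j] ij(2) e(2) by auto
    qed
  qed
  then show ?thesis by (simp add: S_def)
qed

text \<open>There are at most two components, and the two sides of an edge of \<open>c\<close>
  differ in colour, so the colour determines the component.\<close>

lemma same_colour_linked:
  assumes c: "c \<in> circles D s" and f: "sides_colouring D s c f"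
    and ab: "a \<in> edge_sides D" "b \<in> edge_sides D" "f a = f b"
  shows "(a, b) \<in> (component_rel D s c \<union> (component_rel D s c)\<inverse>)\<^sup>*"
proof -
  let ?R = "(component_rel D s c \<union> (component_rel D s c)\<inverse>)\<^sup>*"
  \<comment> \<open>Mapping an edge side to the set of those linked to it expresses linkedness as an
    equality of values, as \<open>sides_linked_to_circle\<close> requires.\<close>
  define q where "q a = {b. (a, b) \<in> ?R}" for a
  obtain e0 where e0: "e0 \<in> c" using classes_nonempty c unfolding circles_def by blast
  have lk: "q a = q b \<longleftrightarrow> (a, b) \<in> ?R" for a b
  proof
    assume "q a = q b"
    then show "(a, b) \<in> ?R" unfolding q_def by blast
  next
    assume ab: "(a, b) \<in> ?R"
    then have "(b, a) \<in> ?R" by (rule symclosure_sym)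
    with ab show "q a = q b" unfolding q_def by (auto intro: rtrancl_trans)
  qed
  have qrel: "q a = q b" if "(a, b) \<in> component_rel D s c" for a b
    unfolding lk using that by blast
  have sub: "{q (e, LeftSide), q (e, RightSide)} \<subseteq> {q (e0, LeftSide), q (e0, RightSide)}" if "e \<in> edges D" for e
    by (rule sides_linked_to_circle[OF c e0 that]) (rule qrel)
  have in_sub: "q a \<in> {q (e0, LeftSide), q (e0, RightSide)}" if "a \<in> edge_sides D" for a
  proof -
    obtain e d where a: "a = (e, d)" by (cases a)
    then have "e \<in> edges D" using that by (simp add: edge_sides_def)
    from sub[OF this] show ?thesis unfolding a by (cases d) blast+
  qed
  have fq: "f a = f b" if "q a = q b" for a b
    using symclosure_invariant[of a b "component_rel D s c" f] f that
    unfolding lk sides_colouring_def by blast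
  have ne: "f (e0, LeftSide) \<noteq> f (e0, RightSide)" using f e0 unfolding sides_colouring_def by blast
  have "q a = q b"
    using in_sub[OF ab(1)] in_sub[OF ab(2)] fq[of a "(e0, LeftSide)"] fq[of a "(e0, RightSide)"]
      fq[of b "(e0, LeftSide)"] fq[of b "(e0, RightSide)"] ne ab(3) by auto
  then show ?thesis using lk by blast
qed

lemma region_sides_differ:
  assumes "r \<in> regions D" "e \<in> edges D"
  shows "\<not> ((e, LeftSide) \<in> r \<and> (e, RightSide) \<in> r)"
proof -
  \<comment> \<open>Each crossing has four half-edges, so the set of all edges is even; what it
    bounds is the checkerboard colouring.\<close>
  have even: "boundary (\<lambda>e. of_bool (e \<in> edges D)) = 0"
    by (auto simp: fun_eq_iff boundary_def sum_lessThan_4 spoke_in_edges)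
  have "(\<lambda>e. of_bool (e \<in> edges D)) \<in> edge_cochains" by simp
  then obtain f where f: "f \<in> colourings"
      "\<And>e. e \<in> edges D \<Longrightarrow> f (e, LeftSide) + f (e, RightSide) = of_bool (e \<in> edges D)"
    by (rule even_edge_set_bounds[OF _ even]) (rule that)
  have "f (e, LeftSide) \<noteq> f (e, RightSide)" using bit_add_neq[OF f(2)[OF assms(2)]] assms(2) by simp
  moreover have "f a = f b" if "a \<in> r" "b \<in> r" for a b
    by (rule symclosure_invariant[OF classes_linked[OF assms(1)[unfolded regions_def] that]])
       (rule colouring_corner[OF f(1)])
  ultimately show ?thesis by blast
qed

text \<open>Reduces the geometric condition in \<open>circle_label\<close> to a comparison of
  colours, tested at any one edge side of the region.\<close>

lemma region_in_component_iff:
  assumes c: "c \<in> circles D s" and f: "sides_colouring D s c f" and r: "r \<in> regions D" "a \<in> r"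
    and b: "b \<in> edge_sides D"
  shows "(\<exists>K\<in>components D s c. b \<notin> K \<and> r \<subseteq> K) \<longleftrightarrow> f a \<noteq> f b"
proof
  assume "\<exists>K\<in>components D s c. b \<notin> K \<and> r \<subseteq> K"
  then obtain K where K: "K \<in> classes (edge_sides D) (component_rel D s c)" "b \<notin> K" "a \<in> K"
    unfolding components_def using r(2) by blast
  have a: "a \<in> edge_sides D" using r classes_subset unfolding regions_def by blast
  show "f a \<noteq> f b"
    using classes_closed[OF K(1,3) same_colour_linked[OF c f a b] b] K(2) by blast
next
  assume ne: "f a \<noteq> f b"
  have a: "a \<in> edge_sides D" using r classes_subset unfolding regions_def by blast
  obtain K where K: "K \<in> classes (edge_sides D) (component_rel D s c)" "a \<in> K"
    using ex_class[OF a] by (rule bexE)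
  have fR: "f x = f y" if "(x, y) \<in> component_rel D s c" for x y
    using f that unfolding sides_colouring_def by blast
  have "b \<notin> K"
  proof
    assume "b \<in> K"
    have "f a = f b"
      by (rule symclosure_invariant[OF classes_linked[OF K(1,2) \<open>b \<in> K\<close>]]) (rule fR)
    with ne show False ..
  qed
  moreover have "r \<subseteq> K"
  proof
    fix b assume b: "b \<in> r"
    have "(corner_rel D \<union> (corner_rel D)\<inverse>)\<^sup>* \<subseteq> (component_rel D s c \<union> (component_rel D s c)\<inverse>)\<^sup>*"
      by (rule rtrancl_mono) blast
    then have "(a, b) \<in> (component_rel D s c \<union> (component_rel D s c)\<inverse>)\<^sup>*"
      using classes_linked[OF r(1)[unfolded regions_def] r(2) b] by blast
    moreover have "b \<in> edge_sides D" using b r classes_subset unfolding regions_def by blast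
    ultimately show "b \<in> K" by (rule classes_closed[OF K])
  qed
  ultimately show "\<exists>K\<in>components D s c. b \<notin> K \<and> r \<subseteq> K" unfolding components_def using K(1) by blast
qed

end

section \<open>Labels of circles and sums of weights\<close>

locale numbered_knot =
  fixes D :: diagram and p n m :: nat
    and r :: "nat \<Rightarrow> edge_side set" and e :: "nat \<Rightarrow> nat"
  assumes knot_D: "knot_diagram D"
    and p: "p \<in> edges D"
    and r: "bij_betw r {1..n} (regions D)"
    and adjacent: "(p, LeftSide) \<in> r (n - 1) \<and> (p, RightSide) \<in> r n \<or>
         (p, LeftSide) \<in> r n \<and> (p, RightSide) \<in> r (n - 1)"
    and e: "bij_betw e {1..m} (edges D - {p})"
begin

lemma n_eq: "n = length D + 2"
  using bij_betw_same_card[OF r] knot_D by (simp add: knot_diagram_def)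

lemma region: "i \<in> {1..n} \<Longrightarrow> r i \<in> regions D"
  using r bij_betwE by blast

lemma region_unique: "i \<in> {1..n} \<Longrightarrow> j \<in> {1..n} \<Longrightarrow> a \<in> r i \<Longrightarrow> a \<in> r j \<Longrightarrow> i = j"
  by (rule inj_onD[OF bij_betw_imp_inj_on[OF r]
      classes_unique[OF region[unfolded regions_def] region[unfolded regions_def]]])

lemma ex_region:
  assumes "a \<in> edge_sides D"
  obtains i where "i \<in> {1..n}" "a \<in> r i"
proof -
  obtain C where "C \<in> regions D" "a \<in> C" using ex_class[OF assms] unfolding regions_def by (rule bexE)
  then show ?thesis using that bij_betw_imp_surj_on[OF r] by (metis imageE)
qed

lemma e_edge: "j \<in> {1..m} \<Longrightarrow> e j \<in> edges D" "j \<in> {1..m} \<Longrightarrow> e j \<noteq> p"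
  using bij_betwE[OF e] by auto

lemma boundary_edges_iff: "a \<in> boundary_edges R \<longleftrightarrow> (a, LeftSide) \<in> R \<or> (a, RightSide) \<in> R"
proof -
  have "a \<in> boundary_edges R \<longleftrightarrow> (\<exists>d. (a, d) \<in> R)" by (force simp: boundary_edges_def)
  then show ?thesis by (metis side.exhaust)
qed

lemma basepoint_not_in_region:
  assumes "i \<in> {1..n - 2}"
  shows "(p, d) \<notin> r i"
proof
  assume "(p, d) \<in> r i"
  then have "i = n - 1 \<or> i = n"
    using adjacent region_unique[of i "n - 1" "(p, d)"] region_unique[of i n "(p, d)"] assms n_eq
    by (cases d) auto
  then show False using assms n_eq by auto
qed

lemma crossings_exist: "q \<in> edges D \<Longrightarrow> q \<noteq> p \<Longrightarrow> D \<noteq> []"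
  using p by (auto simp: edges_def num_edges_def)

lemma circle_label_eq:
  fixes x w :: "nat \<Rightarrow> 'a::comm_ring_1"
  assumes char2: "\<And>a :: 'a. a + a = 0"
    and x: "\<forall>i \<in> {1..n - 2}. x i = (\<Sum>j | j \<in> {1..m} \<and> e j \<in> boundary_edges (r i). w j)"
    and c: "c \<in> circles D s" "p \<notin> c"
  shows "circle_label D p n r x s c = (\<Sum>j | j \<in> {1..m} \<and> e j \<in> c. w j)"
proof -
  have sub: "c \<subseteq> edges D" and ne: "c \<noteq> {}"
    using c(1) classes_subset classes_nonempty unfolding circles_def by blast+
  \<comment> \<open>A circle avoiding p runs through a second edge, and this forces a
    crossing.\<close>
  have "D \<noteq> []"
  proof -
    obtain q where "q \<in> c" using ne by blast
    then show ?thesis using crossings_exist[of q] sub c(2) by blast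
  qed
  then interpret knot D using knot_D by unfold_locales
  obtain f where f: "sides_colouring D s c f" using ex_sides_colouring[OF c(1)] ..
  have cross: "f (q, LeftSide) \<noteq> f (q, RightSide) \<longleftrightarrow> q \<in> c" if "q \<in> edges D" for q
    using f that unfolding sides_colouring_def by blast
  have sides: "(q, d) \<in> edge_sides D" if "q \<in> edges D" for q d using that by (simp add: edge_sides_def)
  define I where "I = {i \<in> {1..n}. \<exists>K\<in>components D s c. (p, LeftSide) \<notin> K \<and> r i \<subseteq> K}"
  have I: "i \<in> I \<longleftrightarrow> f a \<noteq> f (p, LeftSide)" if "i \<in> {1..n}" "a \<in> r i" for i a
    using region_in_component_iff[OF c(1) f region[OF that(1)] that(2) sides[OF p], of LeftSide] that(1)
    by (simp add: I_def)
  \<comment> \<open>Since p is off \<open>c\<close>, both of its sides have the same colour, so the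
    two regions at the basepoint never enter the label.\<close>
  have In: "i \<in> {1..n - 2}" if "i \<in> I" for i
  proof -
    have pp: "f (p, d) = f (p, LeftSide)" for d using cross[OF p] c(2) by (cases d) auto
    have i: "i \<in> {1..n}" using that by (simp add: I_def)
    have "(p, d) \<notin> r i" for d using I[OF i, of "(p, d)"] pp[of d] that by blast
    then have "i \<noteq> n - 1" "i \<noteq> n" using adjacent by auto
    then show ?thesis using i by auto
  qed
  have finI: "finite I" by (simp add: I_def)
  \<comment> \<open>The edge borders two distinct regions. In characteristic 2 its weight survives
    iff exactly one of them is in \<open>I\<close>, that is, iff the colour changes across the
    edge.\<close>
  have count: "(\<Sum>i\<in>I. if e j \<in> boundary_edges (r i) then w j else 0) = (if e j \<in> c then w j else 0)"
    if j: "j \<in> {1..m}" for j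
  proof -
    obtain a b where a: "a \<in> {1..n}" "(e j, LeftSide) \<in> r a" and b: "b \<in> {1..n}" "(e j, RightSide) \<in> r b"
      using ex_region sides[OF e_edge(1)[OF j]] by metis
    have "a \<noteq> b" using region_sides_differ[OF region[OF a(1)] e_edge(1)[OF j]] a(2) b(2) by blast
    have bd: "e j \<in> boundary_edges (r i) \<longleftrightarrow> i = a \<or> i = b" if "i \<in> I" for i
    proof -
      have "i \<in> {1..n}" using that by (simp add: I_def)
      then show ?thesis unfolding boundary_edges_iff using region_unique a b by blast
    qed
    have "(\<Sum>i\<in>I. if e j \<in> boundary_edges (r i) then w j else 0)
        = (\<Sum>i\<in>I. (if i = a then w j else 0) + (if i = b then w j else 0))"
      by (rule sum.cong) (use bd \<open>a \<noteq> b\<close> in auto)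
    also have "\<dots> = (if a \<in> I then w j else 0) + (if b \<in> I then w j else 0)"
      using finI by (simp add: sum.distrib)
    also have "\<dots> = (if e j \<in> c then w j else 0)"
      using I[OF a] I[OF b] cross[OF e_edge(1)[OF j]] char2
      by (cases "f (e j, LeftSide)"; cases "f (e j, RightSide)"; cases "f (p, LeftSide)") auto
    finally show ?thesis .
  qed
  have "circle_label D p n r x s c = (\<Sum>i\<in>I. x i)" by (simp add: circle_label_def I_def)
  also have "\<dots> = (\<Sum>i\<in>I. \<Sum>j\<in>{1..m}. if e j \<in> boundary_edges (r i) then w j else 0)"
  proof (rule sum.cong[OF refl])
    fix i assume "i \<in> I"
    with x In have "x i = (\<Sum>j | j \<in> {1..m} \<and> e j \<in> boundary_edges (r i). w j)" by blast
    also have "\<dots> = (\<Sum>j\<in>{1..m}. if e j \<in> boundary_edges (r i) then w j else 0)"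
      using sum.inter_filter[of "{1..m}" w "\<lambda>j. e j \<in> boundary_edges (r i)"] by simp
    finally show "x i = (\<Sum>j\<in>{1..m}. if e j \<in> boundary_edges (r i) then w j else 0)" .
  qed
  also have "\<dots> = (\<Sum>j\<in>{1..m}. \<Sum>i\<in>I. if e j \<in> boundary_edges (r i) then w j else 0)"
    by (rule sum.swap)
  also have "\<dots> = (\<Sum>j\<in>{1..m}. if e j \<in> c then w j else 0)"
    by (rule sum.cong[OF refl count])
  also have "\<dots> = (\<Sum>j | j \<in> {1..m} \<and> e j \<in> c. w j)"
    using sum.inter_filter[of "{1..m}" w "\<lambda>j. e j \<in> c"] by simp
  finally show ?thesis .
qed

section \<open>From labels of circles to differentials\<close>

lemma circle_through_unique:
  assumes "a \<in> edges D"
  shows "circle_through D s a \<in> circles D s" "a \<in> circle_through D s a"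
    and "\<And>c. c \<in> circles D s \<Longrightarrow> a \<in> c \<longleftrightarrow> c = circle_through D s a"
proof -
  have ex: "\<exists>!c. c \<in> circles D s \<and> a \<in> c"
  proof -
    obtain c where c: "c \<in> circles D s" "a \<in> c"
      using ex_class[OF assms] unfolding circles_def by (rule bexE)
    moreover have "c' = c" if "c' \<in> circles D s \<and> a \<in> c'" for c'
      using classes_unique[OF _ c(1)[unfolded circles_def] _ c(2)] that unfolding circles_def by blast
    ultimately show ?thesis by blast
  qed
  note the = theI'[OF ex, folded circle_through_def]
  show 1: "circle_through D s a \<in> circles D s" using the by (rule conjunct1)
  show 2: "a \<in> circle_through D s a" using the by (rule conjunct2)
  show "a \<in> c \<longleftrightarrow> c = circle_through D s a" if "c \<in> circles D s" for c
    using ex that 1 2 by blast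
qed

text \<open>Grouping the markings by the circles that carry them gives each multiplication by x the
  total weight on its circle, which is the label of the circle.\<close>

lemma markings_eq_roberts_map:
  fixes x w :: "nat \<Rightarrow> 'a::comm_ring_1"
  assumes char2: "\<And>a :: 'a. a + a = 0"
    and x: "\<forall>i \<in> {1..n - 2}. x i = (\<Sum>j | j \<in> {1..m} \<and> e j \<in> boundary_edges (r i). w j)"
  shows "(\<Sum>j = 1..m. w j * marking_map D p (e j) v h) = roberts_map D p n r x v h"
proof (cases "h \<in> generators D p")
  case True
  have local: "(\<Sum>j = 1..m. w j * (let c = circle_through D s (e j) in if p \<in> c then (\<lambda>_. 0) else mult_x c (s, X)) h)
      = (\<Sum>c | c \<in> circles D s \<and> p \<notin> c. circle_label D p n r x s c * mult_x c (s, X) h)" for s X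
  proof -
    let ?C = "{c \<in> circles D s. p \<notin> c}"
    have fin: "finite ?C" using finite_classes[OF finite_edges] by (simp add: circles_def)
    have "(\<Sum>c\<in>?C. circle_label D p n r x s c * mult_x c (s, X) h)
        = (\<Sum>c\<in>?C. \<Sum>j = 1..m. if e j \<in> c then w j * mult_x c (s, X) h else 0)"
    proof (rule sum.cong[OF refl])
      fix c assume "c \<in> ?C"
      then have "circle_label D p n r x s c = (\<Sum>j | j \<in> {1..m} \<and> e j \<in> c. w j)"
        using circle_label_eq[OF char2 x] by blast
      also have "\<dots> = (\<Sum>j = 1..m. if e j \<in> c then w j else 0)"
        using sum.inter_filter[of "{1..m}" w "\<lambda>j. e j \<in> c"] by simp
      finally show "circle_label D p n r x s c * mult_x c (s, X) h
          = (\<Sum>j = 1..m. if e j \<in> c then w j * mult_x c (s, X) h else 0)"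
        by (simp add: sum_distrib_right if_distrib[of "\<lambda>t. t * _"] cong: if_cong)
    qed
    also have "\<dots> = (\<Sum>j = 1..m. \<Sum>c\<in>?C. if e j \<in> c then w j * mult_x c (s, X) h else 0)"
      by (rule sum.swap)
    also have "\<dots> = (\<Sum>j = 1..m. w j * (let c = circle_through D s (e j) in if p \<in> c then (\<lambda>_. 0) else mult_x c (s, X)) h)"
    proof (rule sum.cong[OF refl])
      fix j assume j: "j \<in> {1..m}"
      let ?c = "circle_through D s (e j)"
      note ct = circle_through_unique[OF e_edge(1)[OF j], where s = s]
      \<comment> \<open>Exactly one circle carries the marking; if it contains p it is missing from
        \<open>?C\<close>, in accordance with the value 0 of the marking map.\<close>
      have "(\<Sum>c\<in>?C. if e j \<in> c then w j * mult_x c (s, X) h else 0)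
          = (\<Sum>c\<in>?C. if c = ?c then w j * mult_x c (s, X) h else 0)"
        by (rule sum.cong[OF refl]) (use ct(3) in simp)
      also have "\<dots> = (if ?c \<in> ?C then w j * mult_x ?c (s, X) h else 0)"
        using fin by (rule sum.delta)
      finally show "(\<Sum>c\<in>?C. if e j \<in> c then w j * mult_x c (s, X) h else 0)
          = w j * (let c = circle_through D s (e j) in if p \<in> c then (\<lambda>_. 0) else mult_x c (s, X)) h"
        using ct(1) by (simp add: Let_def)
    qed
    finally show ?thesis by simp
  qed
  have "(\<Sum>j = 1..m. w j * marking_map D p (e j) v h)
      = (\<Sum>g\<in>generators D p. v g * (\<Sum>j = 1..m. w j * (case g of (s, X) \<Rightarrow>
          let c = circle_through D s (e j) in if p \<in> c then (\<lambda>_. 0) else mult_x c (s, X)) h))"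
    using True unfolding marking_map_def linear_map_def if_P[OF True] sum_distrib_left
    by (subst sum.swap) (simp add: mult.left_commute)
  also have "\<dots> = roberts_map D p n r x v h"
    unfolding roberts_map_def linear_map_def if_P[OF True]
    by (rule sum.cong[OF refl], simp only: split_paired_all prod.case local)
  finally show ?thesis .
qed (simp add: marking_map_def roberts_map_def linear_map_def)

lemma twisted_eq_roberts:
  fixes x w :: "nat \<Rightarrow> 'a::comm_ring_1"
  assumes "\<And>a :: 'a. a + a = 0"
    and "\<forall>i \<in> {1..n - 2}. x i = (\<Sum>j | j \<in> {1..m} \<and> e j \<in> boundary_edges (r i). w j)"
  shows "twisted_complex S D p m e w = roberts_complex S D p n r x"
  unfolding twisted_complex_def roberts_complex_def markings_eq_roberts_map[OF assms] ..

text \<open>The function \<open>\<alpha>\<close> counts modulo 2 how often each edge is crossed by a path in the dual graph that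
  leads from the given edge side to the edge p and avoids crossing p.\<close>

lemma ex_dual_path:
  assumes "a \<in> edge_sides D"
  shows "\<exists>\<alpha> :: nat \<Rightarrow> bit. \<forall>i\<in>{1..n - 2}.
    (\<Sum>j | j \<in> {1..m} \<and> e j \<in> boundary_edges (r i). \<alpha> j) = of_bool (a \<in> r i)"
proof (cases "D = []")
  \<comment> \<open>Without crossings n = 2, and the range of i is empty.\<close>
  case True then show ?thesis using n_eq by simp
next
  case False
  then interpret knot D using knot_D by unfold_locales
  let ?P = "\<lambda>a. \<exists>\<alpha> :: nat \<Rightarrow> bit. \<forall>i\<in>{1..n - 2}.
    (\<Sum>j | j \<in> {1..m} \<and> e j \<in> boundary_edges (r i). \<alpha> j) = of_bool (a \<in> r i)"
  \<comment> \<open>The empty path: p is in the boundary of no region with index at most n -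
    2.\<close>
  have P_p: "?P (p, d)" for d
    using basepoint_not_in_region by (intro exI[of _ "\<lambda>_. 0"]) simp
  have move: "?P (q, d')" if q: "q \<in> edges D" and P: "?P (q, d)" and d: "d \<noteq> d'" for q d d'
  proof (cases "q = p")
    \<comment> \<open>At p the path is not prolonged across the edge but replaced by the empty
      one.\<close>
    case True then show ?thesis using P_p by simp
  next
    case False
    then have "q \<in> e ` {1..m}" using bij_betw_imp_surj_on[OF e] q by simp
    then obtain t where t: "e t = q" "t \<in> {1..m}" by blast
    obtain \<alpha> :: "nat \<Rightarrow> bit" where \<alpha>: "\<And>i. i \<in> {1..n - 2} \<Longrightarrow>
        (\<Sum>j | j \<in> {1..m} \<and> e j \<in> boundary_edges (r i). \<alpha> j) = of_bool ((q, d) \<in> r i)"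
      using P by blast
    \<comment> \<open>Toggling the entry at \<open>t\<close> lets the path start on the other side
      of q. The count is right because q separates two distinct regions.\<close>
    have "(\<Sum>j | j \<in> {1..m} \<and> e j \<in> boundary_edges (r i). \<alpha> j + of_bool (j = t)) = of_bool ((q, d') \<in> r i)"
      if i: "i \<in> {1..n - 2}" for i
    proof -
      let ?J = "{j. j \<in> {1..m} \<and> e j \<in> boundary_edges (r i)}"
      have fin: "finite ?J" by simp
      have "(\<Sum>j\<in>?J. of_bool (j = t)) = (\<Sum>j\<in>?J. if j = t then 1 else (0::bit))"
        by (simp add: of_bool_def)
      also have "\<dots> = of_bool (q \<in> boundary_edges (r i))"
        using t fin by (simp add: of_bool_def)
      finally have "(\<Sum>j\<in>?J. \<alpha> j + of_bool (j = t))
          = of_bool ((q, d) \<in> r i) + of_bool (q \<in> boundary_edges (r i))"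
        using \<alpha>[OF i] by (simp add: sum.distrib)
      also have "\<dots> = of_bool ((q, d') \<in> r i)"
        using region_sides_differ[of "r i" q] region[of i] i q d unfolding boundary_edges_iff
        by (cases d; cases d') auto
      finally show ?thesis .
    qed
    then show ?thesis by blast
  qed
  show ?thesis
  proof (rule edge_side_induct[where P = ?P, OF p P_p assms])
    fix a b assume ab: "(a, b) \<in> corner_rel D"
    have "a \<in> r i \<longleftrightarrow> b \<in> r i" if "i \<in> {1..n - 2}" for i
      using classes_respect[OF _ corner_rel_subset ab, of "r i"] region[of i] that
      by (auto simp: regions_def)
    then show "?P a \<longleftrightarrow> ?P b" by simp
  next
    fix q assume "q \<in> edges D"
    then show "?P (q, LeftSide) \<longleftrightarrow> ?P (q, RightSide)" using move by blast
  qed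
qed

end


section \<open>Rational functions in characteristic two\<close>

lemma f2_poly_double: "(f :: f2_poly) + f = 0"
  by (rule poly_mapping_eqI) (simp only: lookup_add lookup_zero bit_double)

lemma f2_fract_double: "(a :: f2_poly fract) + a = 0"
proof -
  have "(1 :: f2_poly fract) + 1 = 0"
    by (simp only: One_fract_def Zero_fract_def add_fract[OF one_neq_zero one_neq_zero] mult_1 f2_poly_double)
  then show ?thesis by (metis distrib_left mult.right_neutral mult_zero_right)
qed

lemma f2_const_simps: "f2_const 0 = 0" "f2_const 1 = 1"
  by (simp_all add: f2_const_def Zero_fract_def One_fract_def)

lemma f2_const_add: "f2_const (a + b) = f2_const a + f2_const b"
  by (simp add: f2_const_def single_add)

lemma f2_const_sum: "f2_const (\<Sum>j\<in>J. a j) = (\<Sum>j\<in>J. f2_const (a j))"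
  by (induction J rule: infinite_finite_induct) (simp_all add: f2_const_simps f2_const_add)

lemma linear_form_in_f2_ratfuns:
  assumes "V' \<subseteq> V"
  shows "(\<Sum>i\<in>V'. f2_const (a i) * f2_var i) \<in> f2_ratfuns V"
proof -
  have "\<exists>f\<in>f2_polys V. (\<Sum>i\<in>V'. f2_const (a i) * f2_var i) = Fract f 1"
    using assms
  proof (induction V' rule: infinite_finite_induct)
    case (insert i V')
    then obtain f where f: "f \<in> f2_polys V" "(\<Sum>i\<in>V'. f2_const (a i) * f2_var i) = Fract f 1" by auto
    let ?g = "Poly_Mapping.single (Poly_Mapping.single i 1) (a i) + f"
    have "f2_const (a i) * f2_var i = Fract (Poly_Mapping.single (Poly_Mapping.single i 1) (a i)) 1"
      by (simp add: f2_const_def f2_var_def mult_single)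
    then have "(\<Sum>i\<in>insert i V'. f2_const (a i) * f2_var i) = Fract ?g 1"
      using insert f by simp
    moreover have "?g \<in> f2_polys V"
      using f(1) insert.prems keys_add[of "Poly_Mapping.single (Poly_Mapping.single i 1) (a i)" f]
      by (fastforce simp: f2_polys_def split: if_splits)
    ultimately show ?case by blast
  qed (rule bexI[of _ 0]; simp add: Zero_fract_def f2_polys_def)+
  moreover have "1 \<in> f2_polys V" by (simp add: f2_polys_def)
  ultimately show ?thesis unfolding f2_ratfuns_def by force
qed

lemma CHAR_2_double: "CHAR('a::comm_ring_1) = 2 \<Longrightarrow> (a :: 'a) + a = 0"
  using of_nat_CHAR[where 'a = 'a] by (simp add: mult_2[symmetric])

theorem mainTheorem4:
  fixes D :: diagram and p n m :: nat
    and r :: "nat \<Rightarrow> edge_side set" and e :: "nat \<Rightarrow> nat"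
  assumes "knot_diagram D"
    and "p \<in> edges D"
    and "bij_betw r {1..n} (regions D)"
    and "(p, LeftSide) \<in> r (n - 1) \<and> (p, RightSide) \<in> r n \<or>
         (p, LeftSide) \<in> r n \<and> (p, RightSide) \<in> r (n - 1)"
    and "bij_betw e {1..m} (edges D - {p})"
  shows
    "(\<exists>w :: nat \<Rightarrow> f2_poly fract.
        (\<forall>j \<in> {1..m}. w j \<in> f2_ratfuns {1..n - 2} \<and>
           (\<exists>a :: nat \<Rightarrow> bit. w j = (\<Sum>i = 1..n - 2. f2_const (a i) * f2_var i))) \<and>
        (\<forall>x. (\<forall>i \<in> {1..n}. x i \<in> f2_ratfuns {1..n - 2}) \<and> (\<forall>i \<in> {1..n - 2}. x i = f2_var i) \<longrightarrow>
           twisted_complex (f2_ratfuns {1..n - 2}) D p m e w =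
           roberts_complex (f2_ratfuns {1..n - 2}) D p n r x))
     \<and>
     (CHAR('a::comm_ring_1) = 2 \<longrightarrow>
        (\<forall>w x :: nat \<Rightarrow> 'a.
           (\<forall>i \<in> {1..n - 2}. x i = (\<Sum>j | j \<in> {1..m} \<and> e j \<in> boundary_edges (r i). w j)) \<longrightarrow>
           twisted_complex UNIV D p m e w = roberts_complex UNIV D p n r x))"
proof -
  interpret numbered_knot D p n m r e using assms by unfold_locales
  \<comment> \<open>The linear system expressing labels by weights is solved over F2 for each unit
    vector, using a dual path that starts in \<open>r l\<close>.\<close>
  have "\<exists>\<alpha> :: nat \<Rightarrow> bit. \<forall>i\<in>{1..n - 2}.
      (\<Sum>j | j \<in> {1..m} \<and> e j \<in> boundary_edges (r i). \<alpha> j) = of_bool (i = l)"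
    if l: "l \<in> {1..n - 2}" for l
  proof -
    have ln: "l \<in> {1..n}" using l by auto
    obtain a where a: "a \<in> r l" using region[OF ln] classes_nonempty unfolding regions_def by blast
    then have "a \<in> edge_sides D" using region[OF ln] classes_subset unfolding regions_def by blast
    moreover have "a \<in> r i \<longleftrightarrow> i = l" if "i \<in> {1..n - 2}" for i
      using region_unique[OF _ ln _ a, of i] a that by auto
    ultimately show ?thesis using ex_dual_path[of a] by simp
  qed
  then obtain \<alpha> :: "nat \<Rightarrow> nat \<Rightarrow> bit" where \<alpha>: "\<And>l i. l \<in> {1..n - 2} \<Longrightarrow> i \<in> {1..n - 2} \<Longrightarrow>
      (\<Sum>j | j \<in> {1..m} \<and> e j \<in> boundary_edges (r i). \<alpha> l j) = of_bool (i = l)"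
    by metis
  \<comment> \<open>The superposition of these solutions with the variables as coefficients; each
    weight is a linear form by construction.\<close>
  define w where "w j = (\<Sum>l = 1..n - 2. f2_const (\<alpha> l j) * f2_var l)" for j
  have w: "f2_var i = (\<Sum>j | j \<in> {1..m} \<and> e j \<in> boundary_edges (r i). w j)" if i: "i \<in> {1..n - 2}" for i
  proof -
    have "(\<Sum>j | j \<in> {1..m} \<and> e j \<in> boundary_edges (r i). w j)
        = (\<Sum>l = 1..n - 2. f2_const (\<Sum>j | j \<in> {1..m} \<and> e j \<in> boundary_edges (r i). \<alpha> l j) * f2_var l)"
      unfolding w_def f2_const_sum sum_distrib_right by (rule sum.swap)
    also have "\<dots> = (\<Sum>l = 1..n - 2. if l = i then f2_var l else 0)"
      by (rule sum.cong[OF refl]) (use \<alpha>[OF _ i] in \<open>auto simp: f2_const_simps\<close>)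
    also have "\<dots> = f2_var i" using i by simp
    finally show ?thesis by simp
  qed
  show ?thesis
  proof (intro conjI exI[of _ w] ballI impI allI)
    show "w j \<in> f2_ratfuns {1..n - 2}" for j
      unfolding w_def by (rule linear_form_in_f2_ratfuns) simp
    show "\<exists>a. w j = (\<Sum>i = 1..n - 2. f2_const (a i) * f2_var i)" for j
      unfolding w_def by (rule exI[of _ "\<lambda>l. \<alpha> l j"]) (rule refl)
    \<comment> \<open>By the choice of \<open>w\<close> the variables are the sums of weights around
      the regions, so (a) follows from the same identity as (b).\<close>
    show "twisted_complex (f2_ratfuns {1..n - 2}) D p m e w = roberts_complex (f2_ratfuns {1..n - 2}) D p n r x"
      if "(\<forall>i \<in> {1..n}. x i \<in> f2_ratfuns {1..n - 2}) \<and> (\<forall>i \<in> {1..n - 2}. x i = f2_var i)" for x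
      using that w by (intro twisted_eq_roberts f2_fract_double) auto
    show "twisted_complex UNIV D p m e w = roberts_complex UNIV D p n r x"
      if "CHAR('a) = 2" and "\<forall>i \<in> {1..n - 2}. x i = (\<Sum>j | j \<in> {1..m} \<and> e j \<in> boundary_edges (r i). w j)"
      for w x :: "nat \<Rightarrow> 'a"
      by (rule twisted_eq_roberts[OF CHAR_2_double[OF that(1)] that(2)])
  qed
qed

end
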